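(* Let $p,q\ge 1$ and let $K_{p,q}^0$ be the complete tripartite graph with parts $P=\{v_1^P,\dots,v_p^P\}$, $Q=\{v_1^Q,\dots,v_q^Q\}$ and $\{v_0\}$, with one edge between any two vertices in different parts, rooted at $v_0$. Identifying a function $f:P\cup Q\to\mathbb{N}$ with $(f^P;f^Q)=(f(v_1^P),\dots,f(v_p^P);f(v_1^Q),\dots,f(v_q^Q))$, we have $\mathrm{PPF}_{p,q}=\mathrm{PPF}(K_{p,q}^0)$. Consequently $$|\mathrm{PPF}(K_{p,q}^0)|=p^q(q-1)^{p-1}+q^p(p-1)^{q-1}-(p+q-1)(p-1)^{q-1}(q-1)^{p-1}$$ (with the convention $0^0=1$).
   Context: Lattice paths: for a non-decreasing $\mathbf a=(a_1,\dots,a_p)\in\{0,\dots,q\}^p$, $\mathcal L^\perp_{\mathbf a}$ is the lattice path from $(0,0)$ to $(p,q)$ with unit steps $E=(1,0)$, $N=(0,1)$ whose $i$-th $E$ step lies at height $y=a_i$ for each $i\in[p]$. For a non-decreasing $\mathbf b=(b_1,\dots,b_q)\in\{0,\dots,p\}^q$, $\mathcal L_{\mathbf b}$ is the lattice path from $(0,0)$ to $(p,q)$ whose $j$-th $N$ step lies at $x$-coordinate $b_j$. A path $\mathcal L$ lies weakly above $\mathcal L'$ if for every $i\in[p]$ the height of the $i$-th $E$ step of $\mathcal L$ is at least that of $\mathcal L'$. For a vector $u$, $\mathrm{inc}(u)$ is its non-decreasing rearrangement, and $\mathbf 1$ the all-ones vector. A $(p,q)$-parking function is $f=(f^P;f^Q)$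 with $f^P\in[q+1]^p$, $f^Q\in[p+1]^q$ such that, with $\mathbf a=\mathrm{inc}(f^P)-\mathbf 1$ and $\mathbf b=\mathrm{inc}(f^Q)-\mathbf 1$, $\mathcal L_{\mathbf b}$ lies weakly above $\mathcal L^\perp_{\mathbf a}$; it is prime if moreover $\mathcal L^\perp_{\mathbf a}$ and $\mathcal L_{\mathbf b}$ have no common point other than $(0,0)$ and $(p,q)$. $\mathrm{PPF}_{p,q}$ is the set of prime $(p,q)$-parking functions. Graph notions: for a rooted graph $G=(\Gamma,s)$ (finite, undirected, loopless multigraph with sink $s$), $V$ is the vertex set, $\tilde V=V\setminus\{s\}$, $\mathrm{mult}(vw)$ the number of edges between $v,w$, $\deg^A(v)=\sum_{w\in A}\mathrm{mult}(vw)$. A $G$-parking function is $f:\tilde V\to\mathbb{N}=\{1,2,\dots\}$ such that every nonempty $S\subseteq\tilde V$ contains $v$ with $f(v)\le\deg^{V\setminus S}(v)$. With $G^A$ the induced subgraph on $A\cup\{s\}$ rooted at $s$, $f$ is decomposable w.r.t. an ordered partition $(A,B)$ of $\tilde V$ into nonempty blocks if $f|_A$ is a $G^A$-parking function and $v\mapsto f(v)-\deg^A(v)$ on $B$ is a $G^B$-parking function; $f$ is prime if decomposable w.r.t. no such partition; $\mathrm{PPF}(G)$ is the set of prime $G$-parking functions. *)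

theory Defs
  imports Main "HOL-Library.FuncSet"
begin

datatype step = E | N

text \<open>Path from (0,0) whose i-th E step lies at height a_i (a sorted), ending at height q.\<close>
fun pathE_aux :: "nat \<Rightarrow> nat list \<Rightarrow> nat \<Rightarrow> step list" where
  "pathE_aux cur [] q = replicate (q - cur) N"
| "pathE_aux cur (x # xs) q = replicate (x - cur) N @ E # pathE_aux x xs q"

definition pathE :: "nat list \<Rightarrow> nat \<Rightarrow> step list" where
  "pathE a q = pathE_aux 0 a q"

text \<open>Path from (0,0) whose j-th N step lies at x-coordinate b_j (b sorted), ending at x = p.\<close>
fun pathN_aux :: "nat \<Rightarrow> nat list \<Rightarrow> nat \<Rightarrow> step list" where
  "pathN_aux cur [] p = replicate (p - cur) E"
| "pathN_aux cur (x # xs) p = replicate (x - cur) E @ N # pathN_aux x xs p"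

definition pathN :: "nat list \<Rightarrow> nat \<Rightarrow> step list" where
  "pathN b p = pathN_aux 0 b p"

definition nE :: "step list \<Rightarrow> nat" where "nE w = length (filter (\<lambda>s. s = E) w)"
definition nN :: "step list \<Rightarrow> nat" where "nN w = length (filter (\<lambda>s. s = N) w)"

definition path_points :: "step list \<Rightarrow> (nat \<times> nat) set" where
  "path_points w = {(nE (take k w), nN (take k w)) | k. k \<le> length w}"

fun E_heights :: "nat \<Rightarrow> step list \<Rightarrow> nat list" where
  "E_heights h [] = []"
| "E_heights h (E # w) = h # E_heights h w"
| "E_heights h (N # w) = E_heights (Suc h) w"

definition weakly_above :: "nat \<Rightarrow> step list \<Rightarrow> step list \<Rightarrow> bool" where
  "weakly_above p L L' \<longleftrightarrow>
     (\<forall>i<p. E_heights 0 L ! i \<ge> E_heights 0 L' ! i)"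

text \<open>Prime (p,q)-parking functions, f = (fP; fQ) as lists (fP ! (i-1) = f(v_i^P)).\<close>
definition PPF_pq :: "nat \<Rightarrow> nat \<Rightarrow> (nat list \<times> nat list) set" where
  "PPF_pq p q = {(fP, fQ). length fP = p \<and> length fQ = q \<and>
      set fP \<subseteq> {1..q+1} \<and> set fQ \<subseteq> {1..p+1} \<and>
      (let a = map (\<lambda>x. x - 1) (sort fP); b = map (\<lambda>x. x - 1) (sort fQ) in
         weakly_above p (pathN b p) (pathE a q) \<and>
         path_points (pathE a q) \<inter> path_points (pathN b p) \<subseteq> {(0,0), (p,q)})}"

text \<open>A rooted multigraph: multiplicity function mult (symmetric, loopless), vertex set V, sink s.\<close>
definition deg :: "('v \<Rightarrow> 'v \<Rightarrow> nat) \<Rightarrow> 'v set \<Rightarrow> 'v \<Rightarrow> nat" where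
  "deg mult A v = (\<Sum>w\<in>A. mult v w)"

text \<open>G-parking function (values taken in int so that shifted functions can be tested).\<close>
definition is_gpf :: "('v \<Rightarrow> 'v \<Rightarrow> nat) \<Rightarrow> 'v set \<Rightarrow> 'v \<Rightarrow> ('v \<Rightarrow> int) \<Rightarrow> bool" where
  "is_gpf mult V s f \<longleftrightarrow>
     (\<forall>v\<in>V - {s}. f v \<ge> 1) \<and>
     (\<forall>S. S \<subseteq> V - {s} \<and> S \<noteq> {} \<longrightarrow> (\<exists>v\<in>S. f v \<le> int (deg mult (V - S) v)))"

definition decomposable :: "('v \<Rightarrow> 'v \<Rightarrow> nat) \<Rightarrow> 'v set \<Rightarrow> 'v \<Rightarrow> ('v \<Rightarrow> nat) \<Rightarrow> 'v set \<Rightarrow> 'v set \<Rightarrow> bool" where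
  "decomposable mult V s f A B \<longleftrightarrow>
     is_gpf mult (A \<union> {s}) s (\<lambda>v. int (f v)) \<and>
     is_gpf mult (B \<union> {s}) s (\<lambda>v. int (f v) - int (deg mult A v))"

definition PPF_graph :: "('v \<Rightarrow> 'v \<Rightarrow> nat) \<Rightarrow> 'v set \<Rightarrow> 'v \<Rightarrow> ('v \<Rightarrow> nat) set" where
  "PPF_graph mult V s = {f \<in> (V - {s}) \<rightarrow>\<^sub>E {1..}.
      is_gpf mult V s (\<lambda>v. int (f v)) \<and>
      \<not> (\<exists>A B. A \<noteq> {} \<and> B \<noteq> {} \<and> A \<union> B = V - {s} \<and> A \<inter> B = {} \<and>
              decomposable mult V s f A B)}"

datatype kv = V0 | VP nat | VQ nat

fun kpart :: "kv \<Rightarrow> nat" where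
  "kpart V0 = 0" | "kpart (VP _) = 1" | "kpart (VQ _) = 2"

definition Kmult :: "kv \<Rightarrow> kv \<Rightarrow> nat" where
  "Kmult v w = (if kpart v \<noteq> kpart w then 1 else 0)"

definition KV :: "nat \<Rightarrow> nat \<Rightarrow> kv set" where
  "KV p q = {V0} \<union> VP ` {1..p} \<union> VQ ` {1..q}"

end

theory Submission
  imports Defs
begin

text \<open>
  Both notions of primality amount to one condition on counts. With \<open>P = {v\<^sub>1,\<dots>,v\<^sub>p}\<close> and
  \<open>Q = {w\<^sub>1,\<dots>,w\<^sub>q}\<close>, the condition is that for every lattice point \<open>(x, y) \<noteq> (0, 0), (p, q)\<close> of the
  \<open>p \<times> q\<close> box more than \<open>x\<close> of the values on \<open>P\<close> are at most \<open>y\<close>, or more than \<open>y\<close> of the values on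
  \<open>Q\<close> are at most \<open>x\<close>. On the graph this says that every nonempty proper set \<open>S\<close> of non-sink vertices
  contains some \<open>v\<close> with \<open>f v \<le> deg v\<close>, where the degree is taken into the other non-sink vertices.

  For the enumeration, consider functions on \<open>P \<union> Q\<close> that are parking with the \<open>s\<close> (on \<open>P\<close>) or \<open>t\<close>
  (on \<open>Q\<close>) smallest values allowed from the start. Removing the vertices that are allowed from the
  start leaves a smaller instance, in which \<open>s, t\<close> are the numbers of removed vertices on the
  opposite side. By this recursion and the binomial theorem, their number is
  \<open>(s + q)\<^sup>p (t + p)\<^sup>q - p q (s + q)\<^sup>p\<^sup>-\<^sup>1 (t + p)\<^sup>q\<^sup>-\<^sup>1\<close>. A prime function is determined by the set of vertices
  where it is 1, say \<open>i\<close> in \<open>P\<close> and \<open>j\<close> in \<open>Q\<close>, and an instance with \<open>s = j - 1\<close>, \<open>t = i - 1\<close> on the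
  remaining vertices; summing over \<open>i, j \<ge> 1\<close> gives the formula.
\<close>

section \<open>Parking functions with thresholds\<close>

lemma deg_Un_disjoint:
  assumes "finite A" "finite B" "A \<inter> B = {}"
  shows "deg m (A \<union> B) v = deg m A v + deg m B v"
  unfolding deg_def using assms by (rule sum.union_disjoint)

lemma deg_mono: "finite B \<Longrightarrow> A \<subseteq> B \<Longrightarrow> deg m A v \<le> deg m B v"
  unfolding deg_def by (simp add: sum_mono2)

lemma deg_diff_split:
  assumes "finite V" "I \<subseteq> V" "S \<subseteq> V - I"
  shows "deg m (V - S) v = deg m I v + deg m (V - I - S) v"
proof -
  have "V - S = I \<union> (V - I - S)" using assms by auto
  moreover have "deg m (I \<union> (V - I - S)) v = deg m I v + deg m (V - I - S) v"
    using assms by (intro deg_Un_disjoint) (auto intro: finite_subset)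
  ultimately show ?thesis by simp
qed

text \<open>With \<open>c v = m v s\<close> this is the usual parking condition for values shifted
  down by one, so that they start at 0. A general \<open>c\<close> acts like sink edges whose
  multiplicity depends on the vertex, which is the form that survives the removal of
  vertices.\<close>

definition thr_parking :: "('v \<Rightarrow> 'v \<Rightarrow> nat) \<Rightarrow> 'v set \<Rightarrow> ('v \<Rightarrow> nat) \<Rightarrow> ('v \<Rightarrow> nat) set" where
  "thr_parking m V c = {f \<in> V \<rightarrow>\<^sub>E UNIV.
     \<forall>S\<subseteq>V. S \<noteq> {} \<longrightarrow> (\<exists>v\<in>S. f v < c v + deg m (V - S) v)}"

lemma thr_parking_cong:
  assumes "\<And>v. v \<in> V \<Longrightarrow> c v = d v"
  shows "thr_parking m V c = thr_parking m V d"
proof -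
  have "(\<exists>v\<in>S. f v < c v + deg m (V - S) v) \<longleftrightarrow> (\<exists>v\<in>S. f v < d v + deg m (V - S) v)"
    if "S \<subseteq> V" for S and f :: "'a \<Rightarrow> nat"
    using assms that by (intro bex_cong) auto
  then show ?thesis by (simp add: thr_parking_def cong: imp_cong)
qed

lemma thr_parking_extensional: "f \<in> thr_parking m V c \<Longrightarrow> f \<in> extensional V"
  by (simp add: thr_parking_def PiE_def)

lemma finite_thr_parking:
  assumes "finite V"
  shows "finite (thr_parking m V c)"
proof (rule finite_subset)
  show "thr_parking m V c \<subseteq> (\<Pi>\<^sub>E v\<in>V. {..<c v + deg m (V - {v}) v})"
  proof
    fix f assume f: "f \<in> thr_parking m V c"
    have "f v < c v + deg m (V - {v}) v" if "v \<in> V" for v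
    proof -
      have "\<exists>w\<in>{v}. f w < c w + deg m (V - {v}) w"
        using f that unfolding thr_parking_def by blast
      then show ?thesis by simp
    qed
    then show "f \<in> (\<Pi>\<^sub>E v\<in>V. {..<c v + deg m (V - {v}) v})"
      using thr_parking_extensional[OF f] by (simp add: PiE_iff)
  qed
  show "finite (\<Pi>\<^sub>E v\<in>V. {..<c v + deg m (V - {v}) v})"
    using assms by (intro finite_PiE) auto
qed

lemma thr_parking_zero: "V \<noteq> {} \<Longrightarrow> thr_parking m V (\<lambda>_. 0) = {}"
proof (rule equals0I)
  fix f assume V: "V \<noteq> {}" and f: "f \<in> thr_parking m V (\<lambda>_. 0)"
  then obtain v where "f v < 0 + deg m (V - V) v"
    unfolding thr_parking_def by blast
  then show False by (simp add: deg_def)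
qed

lemma thr_parking_empty: "thr_parking m {} c = {\<lambda>_. undefined}"
  by (simp add: thr_parking_def)

text \<open>A set \<open>S\<close> meeting \<open>I\<close> contains a vertex below its own
  threshold and passes at once. For \<open>S\<close> avoiding \<open>I\<close>, the degree into
  \<open>V - S\<close> splits into the part in \<open>I\<close> and the rest. Off \<open>I\<close>
  the values are at least \<open>c\<close>, so subtracting \<open>c\<close> truncates nothing and
  the degree into \<open>I\<close> becomes the new threshold.\<close>

lemma thr_parking_peel:
  assumes V: "finite V" "I \<subseteq> V" and I: "{v \<in> V. f v < c v} = I"
  shows "(\<forall>S\<subseteq>V. S \<noteq> {} \<longrightarrow> (\<exists>v\<in>S. f v < c v + deg m (V - S) v)) \<longleftrightarrow>
    (\<forall>S\<subseteq>V - I. S \<noteq> {} \<longrightarrow> (\<exists>v\<in>S. f v - c v < deg m I v + deg m (V - I - S) v))"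
    (is "?L \<longleftrightarrow> ?R")
proof -
  have *: "f v - c v < deg m I v + deg m (V - I - S) v \<longleftrightarrow> f v < c v + deg m (V - S) v"
    if "S \<subseteq> V - I" "v \<in> S" for S v
  proof -
    have "c v \<le> f v" using that I by (metis (lifting) DiffD1 DiffD2 mem_Collect_eq not_le subsetD)
    then show ?thesis using deg_diff_split[OF V that(1), of m v] by linarith
  qed
  show ?thesis
  proof
    assume L: ?L
    show ?R
    proof (intro allI impI)
      fix S assume S: "S \<subseteq> V - I" "S \<noteq> {}"
      then obtain v where "v \<in> S" "f v < c v + deg m (V - S) v" using L by blast
      then show "\<exists>v\<in>S. f v - c v < deg m I v + deg m (V - I - S) v"
        using *[OF S(1)] by blast
    qed
  next
    assume R: ?R
    show ?L
    proof (intro allI impI)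
      fix S assume S: "S \<subseteq> V" "S \<noteq> {}"
      show "\<exists>v\<in>S. f v < c v + deg m (V - S) v"
      proof (cases "S \<subseteq> V - I")
        case True
        then obtain v where "v \<in> S" "f v - c v < deg m I v + deg m (V - I - S) v" using R S by blast
        then show ?thesis using *[OF True] by blast
      next
        case False
        then obtain v where "v \<in> S" "v \<in> I" using S by blast
        moreover have "f v < c v" using \<open>v \<in> I\<close> I by blast
        ultimately show ?thesis by (meson trans_less_add1)
      qed
    qed
  qed
qed

lemma card_fibres:
  assumes "finite A" "finite B" "\<And>x. x \<in> A \<Longrightarrow> g x \<in> B"
  shows "card A = (\<Sum>y\<in>B. card {x \<in> A. g x = y})"
proof -
  have "(\<Sum>y\<in>B. \<Sum>x\<in>{x \<in> A. g x = y}. 1) = (\<Sum>x\<in>A. (1::nat))"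
    using assms by (intro sum.group) auto
  then show ?thesis by simp
qed

text \<open>Values on \<open>I\<close> can be chosen freely below \<open>c\<close>, which gives the
  product. By \<open>thr_parking_peel\<close> the values off \<open>I\<close>, lowered by
  \<open>c\<close>, form an independent threshold instance on \<open>V - I\<close>.\<close>

lemma card_thr_parking_fibre:
  assumes V: "finite V" "I \<subseteq> V"
  shows "card {f \<in> thr_parking m V c. {v \<in> V. f v < c v} = I} =
    (\<Prod>v\<in>I. c v) * card (thr_parking m (V - I) (deg m I))"
proof -
  let ?F = "{f \<in> thr_parking m V c. {v \<in> V. f v < c v} = I}"
  let ?G = "(\<Pi>\<^sub>E v\<in>I. {..<c v}) \<times> thr_parking m (V - I) (deg m I)"
  have "bij_betw (\<lambda>f. (restrict f I, \<lambda>v\<in>V - I. f v - c v)) ?F ?G"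
  proof (rule bij_betw_byWitness[where f' = "\<lambda>(g, h). \<lambda>v\<in>V. if v \<in> I then g v else h v + c v"])
    show "\<forall>f\<in>?F. (case (restrict f I, \<lambda>v\<in>V - I. f v - c v) of (g, h) \<Rightarrow>
        \<lambda>v\<in>V. if v \<in> I then g v else h v + c v) = f"
    proof
      fix f assume f: "f \<in> ?F"
      have "{v \<in> V. f v < c v} = I" using f by blast
      then have "v \<in> V \<Longrightarrow> v \<notin> I \<Longrightarrow> c v \<le> f v" for v by (metis (lifting) mem_Collect_eq not_le)
      moreover have "f \<in> extensional V" using f thr_parking_extensional by blast
      ultimately show "(case (restrict f I, \<lambda>v\<in>V - I. f v - c v) of (g, h) \<Rightarrow>
        \<lambda>v\<in>V. if v \<in> I then g v else h v + c v) = f"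
        using V by (auto simp: fun_eq_iff extensional_def)
    qed
    show "\<forall>x\<in>?G. (\<lambda>f. (restrict f I, \<lambda>v\<in>V - I. f v - c v))
       (case x of (g, h) \<Rightarrow> \<lambda>v\<in>V. if v \<in> I then g v else h v + c v) = x"
      using V by (auto simp: fun_eq_iff PiE_def extensional_def dest!: thr_parking_extensional)
    show "(\<lambda>f. (restrict f I, \<lambda>v\<in>V - I. f v - c v)) ` ?F \<subseteq> ?G"
    proof (rule image_subsetI)
      fix f assume f: "f \<in> ?F"
      then have I: "{v \<in> V. f v < c v} = I" by blast
      have "\<forall>S\<subseteq>V - I. S \<noteq> {} \<longrightarrow> (\<exists>v\<in>S. f v - c v < deg m I v + deg m (V - I - S) v)"
        using f unfolding thr_parking_peel[OF V I, symmetric] by (simp add: thr_parking_def)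
      then have "\<forall>S\<subseteq>V - I. S \<noteq> {} \<longrightarrow>
          (\<exists>v\<in>S. (\<lambda>v\<in>V - I. f v - c v) v < deg m I v + deg m (V - I - S) v)"
        by (metis (no_types, lifting) restrict_apply' subsetD)
      then have "(\<lambda>v\<in>V - I. f v - c v) \<in> thr_parking m (V - I) (deg m I)"
        unfolding thr_parking_def by simp
      then show "(restrict f I, \<lambda>v\<in>V - I. f v - c v) \<in> ?G" using I by auto
    qed
    show "(\<lambda>(g, h). \<lambda>v\<in>V. if v \<in> I then g v else h v + c v) ` ?G \<subseteq> ?F"
    proof (rule image_subsetI)
      fix x assume "x \<in> ?G"
      then obtain g h where x: "x = (g, h)" and
        g: "g \<in> (\<Pi>\<^sub>E v\<in>I. {..<c v})" and h: "h \<in> thr_parking m (V - I) (deg m I)" by blast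
      let ?f = "\<lambda>v\<in>V. if v \<in> I then g v else h v + c v"
      have I: "{v \<in> V. ?f v < c v} = I" using g V by (auto simp: PiE_iff)
      have "\<forall>S\<subseteq>V - I. S \<noteq> {} \<longrightarrow> (\<exists>v\<in>S. ?f v - c v < deg m I v + deg m (V - I - S) v)"
      proof (intro allI impI)
        fix S assume S: "S \<subseteq> V - I" "S \<noteq> {}"
        then obtain v where v: "v \<in> S" "h v < deg m I v + deg m (V - I - S) v"
          using h unfolding thr_parking_def by blast
        then have "?f v - c v < deg m I v + deg m (V - I - S) v" using S by auto
        then show "\<exists>v\<in>S. ?f v - c v < deg m I v + deg m (V - I - S) v" using v by blast
      qed
      then have "\<forall>S\<subseteq>V. S \<noteq> {} \<longrightarrow> (\<exists>v\<in>S. ?f v < c v + deg m (V - S) v)"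
        by (rule iffD2[OF thr_parking_peel[OF V I]])
      then have "?f \<in> thr_parking m V c"
        unfolding thr_parking_def by simp
      then show "(case x of (g, h) \<Rightarrow> \<lambda>v\<in>V. if v \<in> I then g v else h v + c v) \<in> ?F"
        using I x by simp
    qed
  qed
  then have "card ?F = card ?G" by (rule bij_betw_same_card)
  also have "\<dots> = (\<Prod>v\<in>I. c v) * card (thr_parking m (V - I) (deg m I))"
    using V by (simp add: card_cartesian_product card_PiE finite_subset)
  finally show ?thesis .
qed

lemma card_thr_parking_rec:
  assumes "finite V"
  shows "card (thr_parking m V c) =
    (\<Sum>I\<in>Pow V. (\<Prod>v\<in>I. c v) * card (thr_parking m (V - I) (deg m I)))"
proof -
  have "card (thr_parking m V c) =
      (\<Sum>I\<in>Pow V. card {f \<in> thr_parking m V c. {v \<in> V. f v < c v} = I})"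
    using assms by (intro card_fibres) (auto simp: finite_thr_parking)
  also have "\<dots> = (\<Sum>I\<in>Pow V. (\<Prod>v\<in>I. c v) * card (thr_parking m (V - I) (deg m I)))"
    using assms by (intro sum.cong refl card_thr_parking_fibre) auto
  finally show ?thesis .
qed

section \<open>Binomial sums over subsets\<close>

lemma sum_Pow_insert:
  fixes g :: "'a set \<Rightarrow> 'b::comm_monoid_add"
  assumes "finite X" "x \<notin> X"
  shows "(\<Sum>A\<in>Pow (insert x X). g A) = (\<Sum>A\<in>Pow X. g A) + (\<Sum>A\<in>Pow X. g (insert x A))"
proof -
  have "inj_on (insert x) (Pow X)" using assms by (auto simp: inj_on_def)
  moreover have "Pow X \<inter> insert x ` Pow X = {}" using assms by auto
  ultimately show ?thesis using assms
    by (simp add: Pow_insert sum.union_disjoint sum.reindex)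
qed

lemma sum_Pow_power:
  fixes a b :: "'a::comm_semiring_1"
  assumes "finite X"
  shows "(\<Sum>A\<in>Pow X. a ^ card A * b ^ card (X - A)) = (a + b) ^ card X"
  using assms
proof (induction X)
  case (insert x X)
  have 1: "(\<Sum>A\<in>Pow X. a ^ card A * b ^ card (insert x X - A)) =
      (\<Sum>A\<in>Pow X. b * (a ^ card A * b ^ card (X - A)))"
  proof (rule sum.cong)
    fix A assume "A \<in> Pow X"
    then have "insert x X - A = insert x (X - A)" "x \<notin> X - A" using insert by auto
    then show "a ^ card A * b ^ card (insert x X - A) = b * (a ^ card A * b ^ card (X - A))"
      using insert by (simp add: mult_ac)
  qed simp
  have 2: "(\<Sum>A\<in>Pow X. a ^ card (insert x A) * b ^ card (insert x X - insert x A)) =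
      (\<Sum>A\<in>Pow X. a * (a ^ card A * b ^ card (X - A)))"
  proof (rule sum.cong)
    fix A assume "A \<in> Pow X"
    then have "insert x X - insert x A = X - A" "x \<notin> A" "finite A"
      using insert by (auto intro: finite_subset)
    then show "a ^ card (insert x A) * b ^ card (insert x X - insert x A) = a * (a ^ card A * b ^ card (X - A))"
      by (simp add: mult_ac)
  qed simp
  show ?case unfolding sum_Pow_insert[OF insert.hyps] 1 2
    using insert by (simp add: algebra_simps flip: sum_distrib_left)
qed simp

text \<open>Formally the derivative of \<open>sum_Pow_power\<close> with respect to
  \<open>b\<close>. The factor \<open>card (X - A)\<close> counts the choices of a point
  \<open>x\<close> outside \<open>A\<close>; after exchanging the sums, \<open>sum_Pow_power\<close>
  applies to \<open>X - {x}\<close>.\<close>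

lemma sum_Pow_power_deriv:
  fixes a b :: "'a::comm_semiring_1"
  assumes "finite X"
  shows "(\<Sum>A\<in>Pow X. a ^ card A * (of_nat (card (X - A)) * b ^ (card (X - A) - 1))) =
    of_nat (card X) * (a + b) ^ (card X - 1)"
proof -
  have "(\<Sum>A\<in>Pow X. a ^ card A * (of_nat (card (X - A)) * b ^ (card (X - A) - 1))) =
    (\<Sum>A\<in>Pow X. \<Sum>x\<in>X - A. a ^ card A * b ^ card (X - {x} - A))"
  proof (intro sum.cong refl)
    fix A assume "A \<in> Pow X"
    have "card (X - {x} - A) = card (X - A) - 1" if "x \<in> X - A" for x
    proof -
      have "X - {x} - A = (X - A) - {x}" by auto
      then show ?thesis using that assms by simp
    qed
    then have "(\<Sum>x\<in>X - A. a ^ card A * b ^ card (X - {x} - A)) =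
       (\<Sum>x\<in>X - A. a ^ card A * b ^ (card (X - A) - 1))" by simp
    then show "a ^ card A * (of_nat (card (X - A)) * b ^ (card (X - A) - 1)) =
       (\<Sum>x\<in>X - A. a ^ card A * b ^ card (X - {x} - A))" by (simp add: mult_ac)
  qed
  also have "\<dots> = (\<Sum>A\<in>Pow X. \<Sum>x\<in>{x\<in>X. x \<notin> A}. a ^ card A * b ^ card (X - {x} - A))"
    by (simp add: set_diff_eq)
  also have "\<dots> = (\<Sum>x\<in>X. \<Sum>A\<in>{A\<in>Pow X. x \<notin> A}. a ^ card A * b ^ card (X - {x} - A))"
    using assms by (intro sum.swap_restrict) auto
  also have "\<dots> = (\<Sum>x\<in>X. \<Sum>A\<in>Pow (X - {x}). a ^ card A * b ^ card (X - {x} - A))"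
    by (intro sum.cong refl) auto
  also have "\<dots> = (\<Sum>x\<in>X. (a + b) ^ (card X - 1))"
    using assms by (intro sum.cong refl) (subst sum_Pow_power, auto)
  finally show ?thesis by simp
qed

text \<open>The graph form of primality: the parking inequality with edges to the sink left out.
  \<open>S = V\<close> is exempt, since there it would ask for a positive value at most 0.\<close>

definition strict_parking :: "('v \<Rightarrow> 'v \<Rightarrow> nat) \<Rightarrow> 'v set \<Rightarrow> ('v \<Rightarrow> nat) set" where
  "strict_parking m V = {f \<in> V \<rightarrow>\<^sub>E {1..}.
     \<forall>S\<subseteq>V. S \<noteq> {} \<longrightarrow> S \<noteq> V \<longrightarrow> (\<exists>v\<in>S. f v \<le> deg m (V - S) v)}"

lemma strict_parking_extensional: "f \<in> strict_parking m V \<Longrightarrow> f \<in> extensional V"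
  by (simp add: strict_parking_def PiE_def)

lemma strict_parking_pos: "f \<in> strict_parking m V \<Longrightarrow> v \<in> V \<Longrightarrow> 1 \<le> f v"
  by (auto simp add: strict_parking_def PiE_iff simp del: One_nat_def)

lemma strict_parkingD:
  "f \<in> strict_parking m V \<Longrightarrow> S \<subseteq> V \<Longrightarrow> S \<noteq> {} \<Longrightarrow> S \<noteq> V \<Longrightarrow> \<exists>v\<in>S. f v \<le> deg m (V - S) v"
  by (simp add: strict_parking_def)

lemma thr_parkingD:
  "f \<in> thr_parking m V c \<Longrightarrow> S \<subseteq> V \<Longrightarrow> S \<noteq> {} \<Longrightarrow> \<exists>v\<in>S. f v < c v + deg m (V - S) v"
  by (simp add: thr_parking_def)

text \<open>Off \<open>I\<close> the values start at 2 and are lowered by 2 to start at 0. The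
  assumption \<open>dom\<close> makes \<open>deg m I v - 1\<close> a genuine subtraction. The
  assumption \<open>touch\<close> handles every proper \<open>S\<close> meeting \<open>I\<close>: it
  contains a vertex of value 1 with a neighbour outside \<open>S\<close>.\<close>

lemma card_strict_parking_fibre:
  assumes V: "finite V" "I \<subseteq> V" and "I \<noteq> {}"
    and dom: "\<And>v. v \<in> V - I \<Longrightarrow> 1 \<le> deg m I v"
    and touch: "\<And>S. S \<subseteq> V \<Longrightarrow> S \<inter> I \<noteq> {} \<Longrightarrow> S \<noteq> V \<Longrightarrow> \<exists>v\<in>S \<inter> I. 1 \<le> deg m (V - S) v"
  shows "card {f \<in> strict_parking m V. {v \<in> V. f v = 1} = I} =
    card (thr_parking m (V - I) (\<lambda>v. deg m I v - 1))"
proof -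
  let ?F = "{f \<in> strict_parking m V. {v \<in> V. f v = 1} = I}"
  let ?G = "thr_parking m (V - I) (\<lambda>v. deg m I v - 1)"
  \<comment> \<open>For \<open>f v = h + 2\<close>, the inequality \<open>h + 2 \<le> d\<close> is
    \<open>h < d - 1\<close>; passing from a weak to a strict inequality absorbs one of the two
    units, and the other lowers the threshold.\<close>
  have shift: "f v - 2 < deg m I v - 1 + deg m (V - I - S) v \<longleftrightarrow> f v \<le> deg m (V - S) v"
    if "S \<subseteq> V - I" "v \<in> S" "2 \<le> f v" for f :: "'a \<Rightarrow> nat" and S v
  proof -
    have "1 \<le> deg m I v" using that by (intro dom) auto
    then show ?thesis using that(3) deg_diff_split[OF V that(1), of m v] by linarith
  qed
  have "bij_betw (\<lambda>f. \<lambda>v\<in>V - I. f v - 2) ?F ?G"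
  proof (rule bij_betw_byWitness[where f' = "\<lambda>h. \<lambda>v\<in>V. if v \<in> I then 1 else h v + 2"])
    have ge2: "2 \<le> f v" if "f \<in> ?F" "v \<in> V - I" for f v
    proof -
      have "1 \<le> f v" using that by (intro strict_parking_pos) auto
      moreover have "f v \<noteq> 1" using that by blast
      ultimately show ?thesis by simp
    qed
    show "\<forall>f\<in>?F. (\<lambda>v\<in>V. if v \<in> I then 1 else (\<lambda>v\<in>V - I. f v - 2) v + 2) = f"
    proof
      fix f assume f: "f \<in> ?F"
      then have e: "f \<in> extensional V" using strict_parking_extensional by blast
      have o: "f v = 1" if "v \<in> I" for v using f that by blast
      show "(\<lambda>v\<in>V. if v \<in> I then 1 else (\<lambda>v\<in>V - I. f v - 2) v + 2) = f"
      proof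
        fix v
        show "(\<lambda>v\<in>V. if v \<in> I then 1 else (\<lambda>v\<in>V - I. f v - 2) v + 2) v = f v"
          using o[of v] ge2[OF f, of v] extensional_arb[OF e, of v] by auto
      qed
    qed
    show "\<forall>h\<in>?G. (\<lambda>v\<in>V - I. (\<lambda>v\<in>V. if v \<in> I then 1 else h v + 2) v - 2) = h"
    proof
      fix h assume "h \<in> ?G"
      then have "h \<in> extensional (V - I)" by (rule thr_parking_extensional)
      then show "(\<lambda>v\<in>V - I. (\<lambda>v\<in>V. if v \<in> I then 1 else h v + 2) v - 2) = h"
        by (auto simp: fun_eq_iff extensional_def)
    qed
    show "(\<lambda>f. \<lambda>v\<in>V - I. f v - 2) ` ?F \<subseteq> ?G"
    proof (rule image_subsetI)
      fix f assume f: "f \<in> ?F"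
      have "\<exists>v\<in>S. (\<lambda>v\<in>V - I. f v - 2) v < deg m I v - 1 + deg m (V - I - S) v"
        if S: "S \<subseteq> V - I" "S \<noteq> {}" for S
      proof -
        have "S \<subseteq> V" "S \<noteq> V" using S V \<open>I \<noteq> {}\<close> by auto
        then obtain v where v: "v \<in> S" "f v \<le> deg m (V - S) v"
          using f strict_parkingD[of f m V S] S by blast
        then have "f v - 2 < deg m I v - 1 + deg m (V - I - S) v"
          using shift[OF S(1) v(1)] ge2[OF f] S by blast
        then show ?thesis using v S by auto
      qed
      then show "(\<lambda>v\<in>V - I. f v - 2) \<in> ?G" unfolding thr_parking_def by simp
    qed
    show "(\<lambda>h. \<lambda>v\<in>V. if v \<in> I then 1 else h v + 2) ` ?G \<subseteq> ?F"
    proof (rule image_subsetI)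
      fix h assume h: "h \<in> ?G"
      let ?f = "\<lambda>v\<in>V. if v \<in> I then 1 else h v + 2"
      have "\<exists>v\<in>S. ?f v \<le> deg m (V - S) v" if S: "S \<subseteq> V" "S \<noteq> {}" "S \<noteq> V" for S
      proof (cases "S \<inter> I = {}")
        case True
        then have SI: "S \<subseteq> V - I" using S by auto
        then obtain v where v: "v \<in> S" "h v < deg m I v - 1 + deg m (V - I - S) v"
          using thr_parkingD[OF h] S by blast
        moreover have fv: "?f v = h v + 2" using v SI by auto
        ultimately have "?f v \<le> deg m (V - S) v" using shift[OF SI v(1), of ?f] by simp
        then show ?thesis using v by blast
      next
        case False
        then obtain v where v: "v \<in> S \<inter> I" "1 \<le> deg m (V - S) v" using touch S by blast
        then have "?f v = 1" using V by auto
        then show ?thesis using v by (metis IntD1)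
      qed
      moreover have "?f \<in> V \<rightarrow>\<^sub>E {1..}" by auto
      ultimately have "?f \<in> strict_parking m V" unfolding strict_parking_def by blast
      moreover have "{v \<in> V. ?f v = 1} = I" using V by auto
      ultimately show "?f \<in> ?F" by blast
    qed
  qed
  then show ?thesis by (rule bij_betw_same_card)
qed

section \<open>Enumeration on the complete bipartite graph\<close>

lemma deg_Kmult_VP:
  assumes "finite A" "finite B"
  shows "deg Kmult (VP ` A \<union> VQ ` B) (VP i) = card B"
proof -
  have "deg Kmult (VP ` A \<union> VQ ` B) (VP i) = deg Kmult (VP ` A) (VP i) + deg Kmult (VQ ` B) (VP i)"
    using assms by (intro deg_Un_disjoint) auto
  moreover have "inj_on VQ B" "inj_on VP A" by (auto intro: inj_onI)
  ultimately show ?thesis by (simp add: deg_def sum.reindex Kmult_def)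
qed

lemma deg_Kmult_VQ:
  assumes "finite A" "finite B"
  shows "deg Kmult (VP ` A \<union> VQ ` B) (VQ j) = card A"
proof -
  have "deg Kmult (VP ` A \<union> VQ ` B) (VQ j) = deg Kmult (VP ` A) (VQ j) + deg Kmult (VQ ` B) (VQ j)"
    using assms by (intro deg_Un_disjoint) auto
  moreover have "inj_on VQ B" "inj_on VP A" by (auto intro: inj_onI)
  ultimately show ?thesis by (simp add: deg_def sum.reindex Kmult_def)
qed

lemma subset_VP_VQ_iff:
  "I \<subseteq> VP ` X \<union> VQ ` Y \<longleftrightarrow> (\<exists>A\<subseteq>X. \<exists>B\<subseteq>Y. I = VP ` A \<union> VQ ` B)"
proof
  assume I: "I \<subseteq> VP ` X \<union> VQ ` Y"
  then have "VP -` I \<subseteq> X" "VQ -` I \<subseteq> Y" "I = VP ` (VP -` I) \<union> VQ ` (VQ -` I)" by auto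
  then show "\<exists>A\<subseteq>X. \<exists>B\<subseteq>Y. I = VP ` A \<union> VQ ` B" by blast
qed auto

lemma sum_Pow_VP_VQ:
  fixes h :: "kv set \<Rightarrow> 'b::comm_monoid_add"
  shows "(\<Sum>I\<in>Pow (VP ` X \<union> VQ ` Y). h I) = (\<Sum>A\<in>Pow X. \<Sum>B\<in>Pow Y. h (VP ` A \<union> VQ ` B))"
proof -
  have "bij_betw (\<lambda>(A, B). VP ` A \<union> VQ ` B) (Pow X \<times> Pow Y) (Pow (VP ` X \<union> VQ ` Y))"
    by (rule bij_betw_byWitness[where f' = "\<lambda>I. (VP -` I, VQ -` I)"]) auto
  then have "(\<Sum>(A, B)\<in>Pow X \<times> Pow Y. h (VP ` A \<union> VQ ` B)) = (\<Sum>I\<in>Pow (VP ` X \<union> VQ ` Y). h I)"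
    by (subst sum.reindex_bij_betw[symmetric]) (auto simp: case_prod_unfold)
  then show ?thesis by (simp add: sum.cartesian_product)
qed

lemma VP_VQ_diff: "(VP ` X \<union> VQ ` Y) - (VP ` A \<union> VQ ` B) = VP ` (X - A) \<union> VQ ` (Y - B)"
  by auto

section \<open>Counting with one constant threshold on each side\<close>

fun side_thr :: "nat \<Rightarrow> nat \<Rightarrow> kv \<Rightarrow> nat" where
  "side_thr s t V0 = 0"
| "side_thr s t (VP _) = s"
| "side_thr s t (VQ _) = t"

lemma prod_side_thr:
  assumes "finite A" "finite B"
  shows "(\<Prod>v\<in>VP ` A \<union> VQ ` B. side_thr s t v) = s ^ card A * t ^ card B"
proof -
  have "(\<Prod>v\<in>VP ` A \<union> VQ ` B. side_thr s t v) = (\<Prod>v\<in>VP ` A. side_thr s t v) * (\<Prod>v\<in>VQ ` B. side_thr s t v)"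
    using assms by (intro prod.union_disjoint) auto
  moreover have "inj_on VQ B" "inj_on VP A" by (auto intro: inj_onI)
  ultimately show ?thesis by (simp add: prod.reindex)
qed

text \<open>The subtracted term is the mixed derivative in \<open>s\<close> and \<open>t\<close> of
  the first product, which is where \<open>sum_Pow_power_deriv\<close> enters. If \<open>P\<close>
  or \<open>Q\<close> is 0, the truncated exponent is harmless because its factor vanishes. Integer
  thresholds allow \<open>bip_count_diff\<close> to subtract \<open>c\<close> without
  truncation.\<close>

definition bip_count :: "nat \<Rightarrow> nat \<Rightarrow> int \<Rightarrow> int \<Rightarrow> int" where
  "bip_count P Q s t = (s + int Q) ^ P * (t + int P) ^ Q
     - (int P * (s + int Q) ^ (P - 1)) * (int Q * (t + int P) ^ (Q - 1))"

lemma bip_count_zero: "P + Q > 0 \<Longrightarrow> bip_count P Q 0 0 = 0"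
  by (cases P; cases Q) (auto simp: bip_count_def)

text \<open>Removing \<open>B\<close> from \<open>Y\<close> while adding \<open>card B\<close> to
  the threshold leaves the base of the power unchanged. The bases therefore do not depend on
  \<open>A\<close> and \<open>B\<close>, as the binomial sums require. The case \<open>c = 0\<close>
  serves the recursion and \<open>c = 1\<close> the count of prime functions.\<close>

lemma bip_count_diff:
  assumes "finite X" "finite Y" "A \<subseteq> X" "B \<subseteq> Y"
  shows "bip_count (card (X - A)) (card (Y - B)) (int (card B) - c) (int (card A) - c) =
    (int (card Y) - c) ^ card (X - A) * (int (card X) - c) ^ card (Y - B)
    - (int (card (X - A)) * (int (card Y) - c) ^ (card (X - A) - 1)) *
      (int (card (Y - B)) * (int (card X) - c) ^ (card (Y - B) - 1))"
proof -
  have "card (X - A) + card A = card X" "card (Y - B) + card B = card Y"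
    using assms by (metis card_Diff_subset card_mono finite_subset le_add_diff_inverse2)+
  then have "int (card B) - c + int (card (Y - B)) = int (card Y) - c"
    "int (card A) - c + int (card (X - A)) = int (card X) - c" by linarith+
  then show ?thesis unfolding bip_count_def by (simp only:)
qed

text \<open>Induction on the number of vertices through \<open>card_thr_parking_rec\<close>: a
  vertex left in one part sees exactly the removed vertices of the other, so the residual instance
  again has one constant threshold per side.\<close>

lemma card_thr_parking_Kmult:
  assumes "finite X" "finite Y"
  shows "int (card (thr_parking Kmult (VP ` X \<union> VQ ` Y) (side_thr s t))) =
    bip_count (card X) (card Y) (int s) (int t)"
  using assms
proof (induction "card X + card Y" arbitrary: X Y s t rule: less_induct)
  case less
  note fin = less.prems
  show ?case
  proof (cases "X = {} \<and> Y = {}")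
    case True
    then show ?thesis by (simp add: thr_parking_empty bip_count_def)
  next
    case False
    let ?p = "int (card X)" and ?q = "int (card Y)"
    \<comment> \<open>Each summand is a difference of two products of a factor in \<open>A\<close>
      and a factor in \<open>B\<close>. The double sum then splits into products of single sums,
      evaluated by the binomial identities.\<close>
    have tm: "int ((\<Prod>v\<in>VP ` A \<union> VQ ` B. side_thr s t v) *
          card (thr_parking Kmult ((VP ` X \<union> VQ ` Y) - (VP ` A \<union> VQ ` B)) (deg Kmult (VP ` A \<union> VQ ` B)))) =
        (int s ^ card A * ?q ^ card (X - A)) * (int t ^ card B * ?p ^ card (Y - B))
        - (int s ^ card A * (of_nat (card (X - A)) * ?q ^ (card (X - A) - 1))) *
          (int t ^ card B * (of_nat (card (Y - B)) * ?p ^ (card (Y - B) - 1)))"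
      if AB: "A \<subseteq> X" "B \<subseteq> Y" for A B
    proof -
      have fAB: "finite A" "finite B" using AB fin finite_subset by auto
      have dg: "thr_parking Kmult (VP ` (X - A) \<union> VQ ` (Y - B)) (deg Kmult (VP ` A \<union> VQ ` B)) =
          thr_parking Kmult (VP ` (X - A) \<union> VQ ` (Y - B)) (side_thr (card B) (card A))"
        using fAB by (intro thr_parking_cong) (auto simp: deg_Kmult_VP deg_Kmult_VQ)
      have eq: "int (card (thr_parking Kmult (VP ` (X - A) \<union> VQ ` (Y - B)) (deg Kmult (VP ` A \<union> VQ ` B)))) =
          bip_count (card (X - A)) (card (Y - B)) (int (card B)) (int (card A))"
      proof (cases "A = {} \<and> B = {}")
        case True
        have "thr_parking Kmult (VP ` X \<union> VQ ` Y) (deg Kmult {}) = {}"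
          using thr_parking_zero[of "VP ` X \<union> VQ ` Y" Kmult] False by (simp add: deg_def[abs_def])
        moreover have "bip_count (card X) (card Y) 0 0 = 0"
          using False fin by (intro bip_count_zero) (auto simp: card_gt_0_iff)
        ultimately show ?thesis using True by simp
      next
        case neq: False
        have "card (X - A) + card (Y - B) < card X + card Y"
        proof (cases "A = {}")
          case True
          then have "card (Y - B) < card Y" using neq AB fin by (intro psubset_card_mono) auto
          then show ?thesis using True by simp
        next
          case False
          then have "card (X - A) < card X" using AB fin by (intro psubset_card_mono) auto
          moreover have "card (Y - B) \<le> card Y" using fin by (intro card_mono) auto
          ultimately show ?thesis by simp
        qed
        then show ?thesis unfolding dg using fin by (intro less.hyps) auto
      qed
      have eq': "bip_count (card (X - A)) (card (Y - B)) (int (card B)) (int (card A)) =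
          ?q ^ card (X - A) * ?p ^ card (Y - B) - (int (card (X - A)) * ?q ^ (card (X - A) - 1)) *
          (int (card (Y - B)) * ?p ^ (card (Y - B) - 1))"
        using bip_count_diff[OF fin AB, of 0] by simp
      show ?thesis unfolding VP_VQ_diff of_nat_mult prod_side_thr[OF fAB] eq eq'
        by (simp add: algebra_simps)
    qed
    have "int (card (thr_parking Kmult (VP ` X \<union> VQ ` Y) (side_thr s t))) =
      (\<Sum>A\<in>Pow X. \<Sum>B\<in>Pow Y. int ((\<Prod>v\<in>VP ` A \<union> VQ ` B. side_thr s t v) *
          card (thr_parking Kmult ((VP ` X \<union> VQ ` Y) - (VP ` A \<union> VQ ` B)) (deg Kmult (VP ` A \<union> VQ ` B)))))"
      using fin by (subst card_thr_parking_rec) (simp_all only: finite_Un finite_imageI sum_Pow_VP_VQ of_nat_sum simp_thms)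
    also have "\<dots> = (\<Sum>A\<in>Pow X. \<Sum>B\<in>Pow Y.
        (int s ^ card A * ?q ^ card (X - A)) * (int t ^ card B * ?p ^ card (Y - B))
        - (int s ^ card A * (of_nat (card (X - A)) * ?q ^ (card (X - A) - 1))) *
          (int t ^ card B * (of_nat (card (Y - B)) * ?p ^ (card (Y - B) - 1))))"
      by (intro sum.cong refl tm) auto
    also have "\<dots> = bip_count (card X) (card Y) (int s) (int t)"
      unfolding sum_subtractf sum_product[symmetric] sum_Pow_power[OF fin(1)] sum_Pow_power[OF fin(2)]
        sum_Pow_power_deriv[OF fin(1)] sum_Pow_power_deriv[OF fin(2)] bip_count_def by simp
    finally show ?thesis .
  qed
qed

section \<open>Counting strict parking functions by their set of ones\<close>

lemma sum_Pow_nonempty: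
  fixes g :: "'a set \<Rightarrow> 'b::ab_group_add"
  assumes "finite X"
  shows "(\<Sum>A\<in>Pow X - {{}}. g A) = (\<Sum>A\<in>Pow X. g A) - g {}"
  using assms by (simp add: sum_diff1)

text \<open>Since \<open>A\<close> and \<open>B\<close> are both nonempty, every vertex has a
  neighbour among the ones; this supplies \<open>dom\<close>, and also \<open>touch\<close> in
  \<open>card_strict_parking_fibre\<close>.\<close>

lemma card_strict_parking_Kmult_fibre:
  assumes fin: "finite X" "finite Y" and A: "A \<subseteq> X" "A \<noteq> {}" and B: "B \<subseteq> Y" "B \<noteq> {}"
  shows "card {f \<in> strict_parking Kmult (VP ` X \<union> VQ ` Y). {v \<in> VP ` X \<union> VQ ` Y. f v = 1} = VP ` A \<union> VQ ` B}
    = card (thr_parking Kmult (VP ` (X - A) \<union> VQ ` (Y - B)) (side_thr (card B - 1) (card A - 1)))"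
proof -
  let ?V = "VP ` X \<union> VQ ` Y" and ?I = "VP ` A \<union> VQ ` B"
  have fAB: "finite A" "finite B" using A B fin finite_subset by auto
  then have pos: "1 \<le> card A" "1 \<le> card B" using A B by (auto simp: Suc_le_eq card_gt_0_iff)
  have "card {f \<in> strict_parking Kmult ?V. {v \<in> ?V. f v = 1} = ?I} =
      card (thr_parking Kmult (?V - ?I) (\<lambda>v. deg Kmult ?I v - 1))"
  proof (rule card_strict_parking_fibre)
    show "1 \<le> deg Kmult ?I v" if "v \<in> ?V - ?I" for v
      using that pos by (auto simp: deg_Kmult_VP deg_Kmult_VQ fAB simp del: One_nat_def)
    fix S assume S: "S \<subseteq> ?V" "S \<inter> ?I \<noteq> {}" "S \<noteq> ?V"
    then obtain C D where CD: "C \<subseteq> X" "D \<subseteq> Y" "S = VP ` C \<union> VQ ` D"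
      unfolding subset_VP_VQ_iff by blast
    have fCD: "finite (X - C)" "finite (Y - D)" using fin by auto
    have VS: "?V - S = VP ` (X - C) \<union> VQ ` (Y - D)" unfolding CD VP_VQ_diff ..
    have ne: "X - C \<noteq> {} \<or> Y - D \<noteq> {}" using S(3) CD(1,2) unfolding CD(3) by blast
    show "\<exists>v\<in>S \<inter> ?I. 1 \<le> deg Kmult (?V - S) v"
    \<comment> \<open>A one of \<open>S\<close> in the first part works if \<open>S\<close> misses
      some vertex of the second. Otherwise either \<open>D = Y\<close> and \<open>S\<close> misses a
      vertex of the first part, or \<open>C\<close> avoids \<open>A\<close>; both times
      \<open>D\<close> meets \<open>B\<close> and \<open>X - C\<close> is nonempty, so a one in the
      second part works.\<close>
    proof (cases "\<exists>i\<in>C \<inter> A. Y - D \<noteq> {}")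
      case True
      then obtain i where i: "i \<in> C \<inter> A" "Y - D \<noteq> {}" by blast
      then have "1 \<le> deg Kmult (?V - S) (VP i)" unfolding VS deg_Kmult_VP[OF fCD]
        using fCD by (simp add: Suc_le_eq card_gt_0_iff)
      then show ?thesis using i by (intro bexI[of _ "VP i"]) (auto simp: CD(3))
    next
      case no: False
      have "\<exists>j\<in>D \<inter> B. X - C \<noteq> {}"
      proof (cases "Y - D = {}")
        case True
        then have "D = Y" "X - C \<noteq> {}" using ne CD(2) by auto
        then show ?thesis using B by blast
      next
        case False
        then have "C \<inter> A = {}" using no by blast
        moreover from this have "D \<inter> B \<noteq> {}" using S(2) unfolding CD(3) by auto
        ultimately show ?thesis using A by blast
      qed
      then obtain j where j: "j \<in> D \<inter> B" "X - C \<noteq> {}" by blast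
      then have "1 \<le> deg Kmult (?V - S) (VQ j)" unfolding VS deg_Kmult_VQ[OF fCD]
        using fCD by (simp add: Suc_le_eq card_gt_0_iff)
      then show ?thesis using j by (intro bexI[of _ "VQ j"]) (auto simp: CD(3))
    qed
  qed (use fin A B in auto)
  also have "thr_parking Kmult (?V - ?I) (\<lambda>v. deg Kmult ?I v - 1) =
      thr_parking Kmult (VP ` (X - A) \<union> VQ ` (Y - B)) (side_thr (card B - 1) (card A - 1))"
    unfolding VP_VQ_diff
    by (intro thr_parking_cong) (auto simp: deg_Kmult_VP deg_Kmult_VQ fAB)
  finally show ?thesis .
qed

text \<open>Test the set of all vertices but one: the degree into the single omitted vertex is at
  most 1, so the vertex found has value 1 and lies in the opposite part.\<close>

lemma strict_parking_Kmult_ones: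
  assumes fin: "finite X" "finite Y" and ne: "X \<noteq> {}" "Y \<noteq> {}"
    and f: "f \<in> strict_parking Kmult (VP ` X \<union> VQ ` Y)"
  shows "\<exists>i\<in>X. f (VP i) = 1" "\<exists>j\<in>Y. f (VQ j) = 1"
proof -
  let ?V = "VP ` X \<union> VQ ` Y"
  obtain i j where ij: "i \<in> X" "j \<in> Y" using ne by blast
  have "\<exists>v\<in>?V - {VQ j}. f v \<le> deg Kmult (?V - (?V - {VQ j})) v"
    by (rule strict_parkingD[OF f]) (use ij in auto)
  moreover have "?V - (?V - {VQ j}) = {VQ j}" using ij by auto
  ultimately obtain v where v: "v \<in> ?V" "f v \<le> deg Kmult {VQ j} v" by auto
  then have "f v = 1 \<and> kpart v = 1"
    using strict_parking_pos[OF f v(1)] by (auto simp: deg_def Kmult_def)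
  then show "\<exists>i\<in>X. f (VP i) = 1" using v(1) by auto
  have "\<exists>v\<in>?V - {VP i}. f v \<le> deg Kmult (?V - (?V - {VP i})) v"
    by (rule strict_parkingD[OF f]) (use ij in auto)
  moreover have "?V - (?V - {VP i}) = {VP i}" using ij by auto
  ultimately obtain w where w: "w \<in> ?V" "f w \<le> deg Kmult {VP i} w" by auto
  then have "f w = 1 \<and> kpart w = 2"
    using strict_parking_pos[OF f w(1)] by (auto simp: deg_def Kmult_def)
  then show "\<exists>j\<in>Y. f (VQ j) = 1" using w(1) by auto
qed

text \<open>With at least two vertices every singleton is a proper subset, and testing it bounds the
  value there. A single vertex would have unbounded values.\<close>

lemma finite_strict_parking:
  assumes "finite V" "2 \<le> card V"
  shows "finite (strict_parking m V)"
proof (rule finite_subset)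
  show "strict_parking m V \<subseteq> (\<Pi>\<^sub>E v\<in>V. {..deg m (V - {v}) v})"
  proof
    fix f assume f: "f \<in> strict_parking m V"
    have "f v \<le> deg m (V - {v}) v" if "v \<in> V" for v
    proof -
      have "{v} \<noteq> V" using assms by auto
      then show ?thesis using strict_parkingD[OF f, of "{v}"] that by simp
    qed
    then show "f \<in> (\<Pi>\<^sub>E v\<in>V. {..deg m (V - {v}) v})"
      using strict_parking_extensional[OF f] by (simp add: PiE_iff)
  qed
  show "finite (\<Pi>\<^sub>E v\<in>V. {..deg m (V - {v}) v})"
    using assms by (intro finite_PiE) auto
qed

lemma card_strict_parking_Kmult:
  assumes fin: "finite X" "finite Y" and ne: "X \<noteq> {}" "Y \<noteq> {}"
  defines "p \<equiv> card X" and "q \<equiv> card Y"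
  shows "int (card (strict_parking Kmult (VP ` X \<union> VQ ` Y))) =
    int p ^ q * (int q - 1) ^ (p - 1) + int q ^ p * (int p - 1) ^ (q - 1)
           - (int p + int q - 1) * (int p - 1) ^ (q - 1) * (int q - 1) ^ (p - 1)"
proof -
  let ?V = "VP ` X \<union> VQ ` Y"
  let ?S = "strict_parking Kmult ?V"
  let ?fib = "\<lambda>I. card {f \<in> ?S. {v \<in> ?V. f v = 1} = I}"
  let ?x = "int p - 1" and ?y = "int q - 1"
  have inj: "inj_on VQ B" "inj_on VP A" for A B by (auto intro: inj_onI)
  have p0: "p > 0" "q > 0" using fin ne by (auto simp: p_def q_def card_gt_0_iff)
  have "card ?V = p + q"
    using fin by (subst card_Un_disjoint) (auto simp: card_image inj p_def q_def)
  then have "finite ?S" using fin p0 by (intro finite_strict_parking) auto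
  then have "card ?S = (\<Sum>I\<in>Pow ?V. ?fib I)"
    using fin by (intro card_fibres) auto
  then have "int (card ?S) = (\<Sum>A\<in>Pow X. \<Sum>B\<in>Pow Y. int (?fib (VP ` A \<union> VQ ` B)))"
    by (simp only: sum_Pow_VP_VQ of_nat_sum)
  \<comment> \<open>By \<open>strict_parking_Kmult_ones\<close> both parts contain a one, so the
    fibres with \<open>A\<close> or \<open>B\<close> empty contribute 0.\<close>
  also have "\<dots> = (\<Sum>A\<in>Pow X - {{}}. \<Sum>B\<in>Pow Y - {{}}. int (?fib (VP ` A \<union> VQ ` B)))"
  proof -
    have z: "?fib (VP ` A \<union> VQ ` B) = 0" if "A = {} \<or> B = {}" for A B
    proof -
      have "{v \<in> ?V. f v = 1} \<noteq> VP ` A \<union> VQ ` B" if f: "f \<in> ?S" for f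
        using strict_parking_Kmult_ones[OF fin ne f] \<open>A = {} \<or> B = {}\<close> by blast
      then have "{f \<in> ?S. {v \<in> ?V. f v = 1} = VP ` A \<union> VQ ` B} = {}" by blast
      then show ?thesis by (simp only: card.empty)
    qed
    define F where "F A B = int (?fib (VP ` A \<union> VQ ` B))" for A B
    have F: "F A B = 0" if "A = {} \<or> B = {}" for A B using z[OF that] by (simp only: F_def of_nat_0)
    have "(\<Sum>B\<in>Pow Y. F A B) = (\<Sum>B\<in>Pow Y - {{}}. F A B)" for A
      using fin by (intro sum.mono_neutral_right) (auto simp: F)
    moreover have "(\<Sum>A\<in>Pow X. \<Sum>B\<in>Pow Y - {{}}. F A B) =
      (\<Sum>A\<in>Pow X - {{}}. \<Sum>B\<in>Pow Y - {{}}. F A B)"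
      using fin by (intro sum.mono_neutral_right) (auto simp: F)
    ultimately show ?thesis unfolding F_def[symmetric] by simp
  qed
  also have "\<dots> = (\<Sum>A\<in>Pow X - {{}}. \<Sum>B\<in>Pow Y - {{}}.
        ?y ^ card (X - A) * ?x ^ card (Y - B)
        - (of_nat (card (X - A)) * ?y ^ (card (X - A) - 1)) *
          (of_nat (card (Y - B)) * ?x ^ (card (Y - B) - 1)))"
  proof (intro sum.cong refl)
    fix A B assume AB: "A \<in> Pow X - {{}}" "B \<in> Pow Y - {{}}"
    then have "finite A" "finite B" using fin finite_subset by auto
    then have "int (card A - 1) = int (card A) - 1" "int (card B - 1) = int (card B) - 1"
      using AB by (auto simp: of_nat_diff Suc_le_eq card_gt_0_iff)
    moreover have "?fib (VP ` A \<union> VQ ` B) =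
      card (thr_parking Kmult (VP ` (X - A) \<union> VQ ` (Y - B)) (side_thr (card B - 1) (card A - 1)))"
      using AB by (intro card_strict_parking_Kmult_fibre fin) auto
    moreover have "int (card (thr_parking Kmult (VP ` (X - A) \<union> VQ ` (Y - B)) (side_thr (card B - 1) (card A - 1)))) =
      bip_count (card (X - A)) (card (Y - B)) (int (card B - 1)) (int (card A - 1))"
      using fin by (intro card_thr_parking_Kmult) auto
    moreover have "bip_count (card (X - A)) (card (Y - B)) (int (card B) - 1) (int (card A) - 1) =
      (int (card Y) - 1) ^ card (X - A) * (int (card X) - 1) ^ card (Y - B)
    - (int (card (X - A)) * (int (card Y) - 1) ^ (card (X - A) - 1)) *
      (int (card (Y - B)) * (int (card X) - 1) ^ (card (Y - B) - 1))"
      using AB by (intro bip_count_diff fin) auto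
    ultimately show "int (?fib (VP ` A \<union> VQ ` B)) = ?y ^ card (X - A) * ?x ^ card (Y - B)
        - (of_nat (card (X - A)) * ?y ^ (card (X - A) - 1)) *
          (of_nat (card (Y - B)) * ?x ^ (card (Y - B) - 1))"
      unfolding p_def q_def by (simp only:)
  qed
  also have "\<dots> = (\<Sum>A\<in>Pow X - {{}}. ?y ^ card (X - A)) * (\<Sum>B\<in>Pow Y - {{}}. ?x ^ card (Y - B))
      - (\<Sum>A\<in>Pow X - {{}}. of_nat (card (X - A)) * ?y ^ (card (X - A) - 1)) *
        (\<Sum>B\<in>Pow Y - {{}}. of_nat (card (Y - B)) * ?x ^ (card (Y - B) - 1))"
    unfolding sum_subtractf sum_product[symmetric] ..
  also have "\<dots> = (int q ^ p - ?y ^ p) * (int p ^ q - ?x ^ q) -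
      (int p * int q ^ (p - 1) - int p * ?y ^ (p - 1)) * (int q * int p ^ (q - 1) - int q * ?x ^ (q - 1))"
    using sum_Pow_power[OF fin(1), of 1 ?y] sum_Pow_power[OF fin(2), of 1 ?x]
      sum_Pow_power_deriv[OF fin(1), of 1 ?y] sum_Pow_power_deriv[OF fin(2), of 1 ?x] fin
    by (simp add: sum_Pow_nonempty p_def q_def)
  also have "\<dots> = int p ^ q * (int q - 1) ^ (p - 1) + int q ^ p * (int p - 1) ^ (q - 1)
           - (int p + int q - 1) * (int p - 1) ^ (q - 1) * (int q - 1) ^ (p - 1)"
  proof -
    \<comment> \<open>The products \<open>q^p * p^q\<close> cancel. With \<open>x = p - 1\<close>
      and \<open>y = q - 1\<close>, the rest collects through \<open>p - x = q - y = 1\<close> and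
      \<open>x * y - p * q = 1 - p - q\<close>. Successors turn the truncated exponents into plain
      ones.\<close>
    obtain P Q where "p = Suc P" "q = Suc Q" using p0 gr0_implies_Suc by blast
    then show ?thesis by (simp add: algebra_simps)
  qed
  finally show ?thesis .
qed

section \<open>Prime parking functions of the graph\<close>

text \<open>The sink always lies outside \<open>S\<close> and contributes its single edge. Integer
  values of \<open>f\<close> let this apply to the shifted functions in \<open>decomposable\<close>
  too.\<close>

lemma is_gpf_insert_sink:
  assumes W: "finite W" "s \<notin> W" and one: "\<forall>v\<in>W. m v s = 1"
  shows "is_gpf m (W \<union> {s}) s f \<longleftrightarrow> (\<forall>v\<in>W. 1 \<le> f v) \<and>
    (\<forall>S\<subseteq>W. S \<noteq> {} \<longrightarrow> (\<exists>v\<in>S. f v \<le> 1 + int (deg m (W - S) v)))"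
proof -
  have W': "W \<union> {s} - {s} = W" using W by auto
  have "int (deg m (W \<union> {s} - S) v) = 1 + int (deg m (W - S) v)" if "S \<subseteq> W" "v \<in> S" for S v
  proof -
    have "W \<union> {s} - S = insert s (W - S)" using that W by auto
    then show ?thesis using W one that by (auto simp: deg_def)
  qed
  then have "(\<exists>v\<in>S. f v \<le> int (deg m (W \<union> {s} - S) v)) \<longleftrightarrow>
      (\<exists>v\<in>S. f v \<le> 1 + int (deg m (W - S) v))" if "S \<subseteq> W" for S
    using that by (intro bex_cong) auto
  then show ?thesis unfolding is_gpf_def W' by (metis (no_types, lifting))
qed

text \<open>The parking inequality on \<open>V - A\<close> is inherited from \<open>f\<close>: for
  \<open>S\<close> inside \<open>V - A\<close>, the degree into \<open>V - S\<close> exceeds the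
  degree into \<open>V - A - S\<close> by exactly the shift \<open>deg m A v\<close>. Positivity of
  the shifted values is the assumption \<open>cut\<close>.\<close>

lemma decomposable_of_cut:
  assumes V: "finite V" "s \<notin> V" and one: "\<forall>v\<in>V. m v s = 1"
    and f: "is_gpf m (V \<union> {s}) s (\<lambda>v. int (f v))" and A: "A \<subseteq> V"
    and fA: "is_gpf m (A \<union> {s}) s (\<lambda>v. int (f v))"
    and cut: "\<And>v. v \<in> V - A \<Longrightarrow> deg m A v < f v"
  shows "decomposable m (V \<union> {s}) s f A (V - A)"
proof -
  have "is_gpf m ((V - A) \<union> {s}) s (\<lambda>v. int (f v) - int (deg m A v))"
  proof (subst is_gpf_insert_sink)
    have "\<exists>v\<in>S. int (f v) - int (deg m A v) \<le> 1 + int (deg m (V - A - S) v)"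
      if S: "S \<subseteq> V - A" "S \<noteq> {}" for S
    proof -
      have "S \<subseteq> V" using S by auto
      then obtain v where v: "v \<in> S" "int (f v) \<le> 1 + int (deg m (V - S) v)"
        using f S unfolding is_gpf_insert_sink[where m = m, OF V one] by blast
      then have "int (f v) - int (deg m A v) \<le> 1 + int (deg m (V - A - S) v)"
        using deg_diff_split[OF V(1) A S(1), of m v] by simp
      then show ?thesis using v by blast
    qed
    moreover have "1 \<le> int (f v) - int (deg m A v)" if "v \<in> V - A" for v
      using cut[OF that] by simp
    ultimately show "(\<forall>v\<in>V - A. 1 \<le> int (f v) - int (deg m A v)) \<and>
      (\<forall>S\<subseteq>V - A. S \<noteq> {} \<longrightarrow> (\<exists>v\<in>S. int (f v) - int (deg m A v) \<le> 1 + int (deg m (V - A - S) v)))"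
      by blast
  qed (use V one in auto)
  then show ?thesis unfolding decomposable_def using fA by blast
qed

text \<open>A proper set violating the strict condition is a candidate second block. Take one of
  maximal size, \<open>T\<close>. If \<open>f\<close> is parking on \<open>V - T\<close>, then
  \<open>(V - T, T)\<close> decomposes \<open>f\<close>. Otherwise all values on
  \<open>V - T\<close> exceed 1, and a single vertex of value 1 can be split off as first
  block.\<close>

lemma PPF_graph_subset_strict_parking:
  assumes fin: "finite X" "finite Y"
  defines "V \<equiv> VP ` X \<union> VQ ` Y"
  assumes f: "f \<in> PPF_graph Kmult (V \<union> {V0}) V0"
  shows "f \<in> strict_parking Kmult V"
proof -
  have V: "finite V" "V0 \<notin> V" using fin by (auto simp: V_def)
  have one: "\<forall>v\<in>V. Kmult v V0 = 1" by (auto simp: V_def Kmult_def)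
  have VV: "V \<union> {V0} - {V0} = V" using V by auto
  have fV: "f \<in> V \<rightarrow>\<^sub>E {1..}" and gpf: "is_gpf Kmult (V \<union> {V0}) V0 (\<lambda>v. int (f v))"
    and prime: "\<And>A B. A \<noteq> {} \<Longrightarrow> B \<noteq> {} \<Longrightarrow> A \<union> B = V \<Longrightarrow> A \<inter> B = {} \<Longrightarrow>
      \<not> decomposable Kmult (V \<union> {V0}) V0 f A B"
    using f unfolding PPF_graph_def VV by blast+
  have pos: "1 \<le> f v" if "v \<in> V" for v using fV that by (auto simp: PiE_iff)
  \<comment> \<open>Primality in the form used below, with natural numbers only: no proper nonempty
    \<open>A\<close> carries a parking function and satisfies the cut inequality.\<close>
  have no_cut: False if "A \<subseteq> V" "A \<noteq> {}" "V - A \<noteq> {}"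
    "\<And>v. v \<in> V - A \<Longrightarrow> deg Kmult A v < f v"
    "\<And>S. S \<subseteq> A \<Longrightarrow> S \<noteq> {} \<Longrightarrow> \<exists>v\<in>S. f v \<le> 1 + deg Kmult (A - S) v" for A
  proof -
    have A: "finite A" "V0 \<notin> A" "\<forall>v\<in>A. Kmult v V0 = 1" "\<And>v. v \<in> A \<Longrightarrow> 1 \<le> int (f v)"
      using that(1) V one pos by (auto intro: finite_subset)
    have "\<exists>v\<in>S. int (f v) \<le> 1 + int (deg Kmult (A - S) v)" if S: "S \<subseteq> A" "S \<noteq> {}" for S
    proof -
      obtain v where v: "v \<in> S" "f v \<le> 1 + deg Kmult (A - S) v"
        using \<open>\<And>S. S \<subseteq> A \<Longrightarrow> S \<noteq> {} \<Longrightarrow> \<exists>v\<in>S. f v \<le> 1 + deg Kmult (A - S) v\<close>[OF S] by blast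
      then have "int (f v) \<le> 1 + int (deg Kmult (A - S) v)" by linarith
      then show ?thesis using v by blast
    qed
    then have "is_gpf Kmult (A \<union> {V0}) V0 (\<lambda>v. int (f v))"
      unfolding is_gpf_insert_sink[where m = Kmult, OF A(1-3)] using A(4) by blast
    then have "decomposable Kmult (V \<union> {V0}) V0 f A (V - A)"
      using that(4) by (intro decomposable_of_cut[where m = Kmult, OF V one gpf that(1)])
    moreover have "A \<union> (V - A) = V" "A \<inter> (V - A) = {}" using that(1) by auto
    ultimately show False using prime[of A "V - A"] that by blast
  qed
  have "\<exists>v\<in>S. f v \<le> deg Kmult (V - S) v" if S0: "S \<subseteq> V" "S \<noteq> {}" "S \<noteq> V" for S
  proof (rule ccontr)
    let ?bad = "\<lambda>S. S \<subseteq> V \<and> S \<noteq> {} \<and> S \<noteq> V \<and> (\<forall>v\<in>S. deg Kmult (V - S) v < f v)"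
    assume "\<not> (\<exists>v\<in>S. f v \<le> deg Kmult (V - S) v)"
    then have "?bad S" using S0 by (auto simp: not_le)
    moreover have "\<forall>S. ?bad S \<longrightarrow> card S < Suc (card V)" using V by (auto simp: less_Suc_eq_le card_mono)
    ultimately obtain T where T: "?bad T" and max: "\<And>S. ?bad S \<Longrightarrow> card S \<le> card T"
      using ex_has_greatest_nat[of ?bad S card "Suc (card V)"] by blast
    let ?A = "V - T"
    have VA: "V - ?A = T" "?A \<subseteq> V" "?A \<noteq> {}" using T by auto
    have fT: "finite T" using T V finite_subset by auto
    \<comment> \<open>By maximality of \<open>T\<close>, only \<open>U = V - T\<close> can obstruct \<open>f\<close> from being parking on \<open>V - T\<close>.\<close>
    have stuck: "U = ?A" if U: "U \<subseteq> ?A" "U \<noteq> {}" "\<forall>v\<in>U. 1 + deg Kmult (?A - U) v < f v" for U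
    proof (rule ccontr)
      assume "U \<noteq> ?A"
      have VTU: "V - (T \<union> U) = ?A - U" by auto
      have "deg Kmult (V - (T \<union> U)) v < f v" if "v \<in> T \<union> U" for v
      proof (cases "v \<in> T")
        case True
        have "deg Kmult (?A - U) v \<le> deg Kmult ?A v" using V by (intro deg_mono) auto
        also have "\<dots> < f v" using T True by blast
        finally show ?thesis unfolding VTU .
      next
        case False
        then have "1 + deg Kmult (?A - U) v < f v" using U that by blast
        then show ?thesis unfolding VTU by simp
      qed
      moreover have "T \<union> U \<subseteq> V" "T \<union> U \<noteq> {}" "T \<union> U \<noteq> V" using T U \<open>U \<noteq> ?A\<close> by auto
      ultimately have "card (T \<union> U) \<le> card T" by (intro max) blast
      moreover have "card T < card (T \<union> U)"
        using U fT V by (intro psubset_card_mono) (auto intro: finite_subset)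
      ultimately show False by simp
    qed
    have "\<exists>U\<subseteq>?A. U \<noteq> {} \<and> (\<forall>v\<in>U. 1 + deg Kmult (?A - U) v < f v)"
    proof (rule ccontr)
      assume *: "\<not> ?thesis"
      show False
      proof (rule no_cut[of ?A])
        show "\<exists>v\<in>S. f v \<le> 1 + deg Kmult (?A - S) v" if "S \<subseteq> ?A" "S \<noteq> {}" for S
          using * that by (meson not_le)
        show "deg Kmult ?A v < f v" if "v \<in> V - ?A" for v using that T unfolding VA by blast
      qed (use VA T in auto)
    qed
    then have "\<forall>v\<in>?A. 1 + deg Kmult (?A - ?A) v < f v" using stuck by blast
    then have big: "1 < f v" if "v \<in> ?A" for v using that by (auto simp: deg_def)
    \<comment> \<open>Tested on all of \<open>V\<close>, the parking condition sees only the sink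
      edges, so some vertex has value 1; it cannot lie in \<open>?A\<close>.\<close>
    have "V \<noteq> {}" using T by auto
    then have "\<exists>v\<in>V. int (f v) \<le> 1 + int (deg Kmult (V - V) v)"
      using gpf unfolding is_gpf_insert_sink[where m = Kmult, OF V one] by blast
    then obtain v where v: "v \<in> V" "f v \<le> 1" by (auto simp: deg_def)
    then have "v \<in> T" using big by force
    \<comment> \<open>\<open>T\<close> is bad, so the degree of \<open>v\<close> into
      \<open>?A\<close> is below \<open>f v \<le> 1\<close>. Having no neighbour there,
      \<open>v\<close> is on the same side as all of \<open>?A\<close>.\<close>
    then have "deg Kmult ?A v = 0" using T v by fastforce
    then have side: "kpart w = kpart v" if "w \<in> ?A" for w
      using that V by (auto simp: deg_def Kmult_def split: if_splits)
    show False
    proof (rule no_cut[of "{v}"])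
      show "V - {v} \<noteq> {}" using VA \<open>v \<in> T\<close> by auto
      show "deg Kmult {v} w < f w" if w: "w \<in> V - {v}" for w
      \<comment> \<open>On the side of \<open>v\<close> there is no edge to \<open>v\<close>. On the
        other side \<open>w\<close> lies in \<open>T\<close> and is adjacent to every vertex of
        \<open>?A\<close>, so badness of \<open>T\<close> forces \<open>f w > 1\<close>.\<close>
      proof (cases "kpart w = kpart v")
        case True
        then show ?thesis using pos[of w] w by (auto simp: deg_def Kmult_def)
      next
        case False
        then have "w \<in> T" using side w by blast
        obtain u where u: "u \<in> ?A" using VA by blast
        have "deg Kmult {v} w \<le> deg Kmult {u} w" using False side[OF u] by (simp add: deg_def Kmult_def)
        also have "\<dots> \<le> deg Kmult ?A w" using u V by (intro deg_mono) auto
        also have "\<dots> < f w" using T \<open>w \<in> T\<close> by blast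
        finally show ?thesis .
      qed
      show "\<exists>w\<in>S. f w \<le> 1 + deg Kmult ({v} - S) w" if "S \<subseteq> {v}" "S \<noteq> {}" for S
        using that v by (auto dest!: subset_singletonD)
    qed (use v in auto)
  qed
  then show ?thesis unfolding strict_parking_def using fV by blast
qed

text \<open>For proper \<open>S\<close> the strict condition implies the parking one, and for
  \<open>S = V\<close> a vertex of value 1 exists. A decomposition \<open>(A, B)\<close> is refuted
  by testing \<open>S = B\<close>: the vertex found has \<open>f v \<le> deg A v\<close>, so its
  shifted value is not positive.\<close>

lemma strict_parking_subset_PPF_graph:
  assumes fin: "finite X" "finite Y" and ne: "X \<noteq> {}" "Y \<noteq> {}"
  defines "V \<equiv> VP ` X \<union> VQ ` Y"
  assumes f: "f \<in> strict_parking Kmult V"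
  shows "f \<in> PPF_graph Kmult (V \<union> {V0}) V0"
proof -
  have V: "finite V" "V0 \<notin> V" using fin by (auto simp: V_def)
  have one: "\<forall>v\<in>V. Kmult v V0 = 1" by (auto simp: V_def Kmult_def)
  have VV: "V \<union> {V0} - {V0} = V" using V by auto
  have "\<exists>v\<in>S. int (f v) \<le> 1 + int (deg Kmult (V - S) v)" if S: "S \<subseteq> V" "S \<noteq> {}" for S
  proof (cases "S = V")
    case True
    obtain i where i: "i \<in> X" "f (VP i) = 1"
      using strict_parking_Kmult_ones[OF fin ne] f unfolding V_def by blast
    moreover have "VP i \<in> S" using i True by (auto simp: V_def)
    ultimately show ?thesis by (intro bexI[of _ "VP i"]) auto
  next
    case False
    then obtain v where v: "v \<in> S" "f v \<le> deg Kmult (V - S) v" using strict_parkingD[OF f S] by blast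
    then have "int (f v) \<le> 1 + int (deg Kmult (V - S) v)" by linarith
    then show ?thesis using v by blast
  qed
  moreover have "1 \<le> int (f v)" if "v \<in> V" for v using strict_parking_pos[OF f that] by simp
  ultimately have "is_gpf Kmult (V \<union> {V0}) V0 (\<lambda>v. int (f v))"
    unfolding is_gpf_insert_sink[where m = Kmult, OF V one] by blast
  moreover have "\<not> decomposable Kmult (V \<union> {V0}) V0 f A B"
    if AB: "A \<noteq> {}" "B \<noteq> {}" "A \<union> B = V" "A \<inter> B = {}" for A B
  proof
    assume d: "decomposable Kmult (V \<union> {V0}) V0 f A B"
    have "B \<union> {V0} - {V0} = B" using AB V by auto
    then have ge: "1 \<le> int (f v) - int (deg Kmult A v)" if "v \<in> B" for v
      using d that unfolding decomposable_def is_gpf_def by blast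
    have "V - B = A" "B \<subseteq> V" "B \<noteq> V" using AB by auto
    then obtain v where "v \<in> B" "f v \<le> deg Kmult A v" using strict_parkingD[OF f, of B] AB by auto
    then show False using ge[of v] by simp
  qed
  moreover have "f \<in> V \<rightarrow>\<^sub>E {1..}" using f by (simp add: strict_parking_def)
  ultimately show ?thesis unfolding PPF_graph_def VV by blast
qed

lemma PPF_graph_KV:
  assumes "1 \<le> p" "1 \<le> q"
  shows "PPF_graph Kmult (KV p q) V0 = strict_parking Kmult (VP ` {1..p} \<union> VQ ` {1..q})"
proof -
  have "KV p q = (VP ` {1..p} \<union> VQ ` {1..q}) \<union> {V0}" by (auto simp: KV_def)
  then show ?thesis
    using PPF_graph_subset_strict_parking[of "{1..p}" "{1..q}"]
      strict_parking_subset_PPF_graph[of "{1..p}" "{1..q}"] assms by auto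
qed

section \<open>Pairs of lattice paths\<close>

abbreviation count_less :: "nat list \<Rightarrow> nat \<Rightarrow> nat" where
  "count_less a y \<equiv> length (filter (\<lambda>x. x < y) a)"

lemma count_less_mono: "y \<le> z \<Longrightarrow> count_less a y \<le> count_less a z"
  by (induction a) auto

lemma count_less_eq_0: "(\<And>x. x \<in> set a \<Longrightarrow> y \<le> x) \<Longrightarrow> count_less a y = 0"
  by (auto simp: filter_empty_conv not_less)

lemma nth_less_iff_count_less:
  assumes "sorted a" "i < length a"
  shows "a ! i < y \<longleftrightarrow> i < count_less a y"
  using assms
proof (induction a arbitrary: i)
  case (Cons z zs)
  show ?case
  proof (cases "z < y")
    case True
    then show ?thesis using Cons by (cases i) auto
  next
    case False
    then have ge: "y \<le> x" if "x \<in> set (z # zs)" for x using that Cons.prems(1) by auto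
    then have "y \<le> (z # zs) ! i" using nth_mem[OF Cons.prems(2)] by blast
    moreover have "count_less (z # zs) y = 0" by (rule count_less_eq_0) (rule ge)
    ultimately show ?thesis by (simp only: not_less[symmetric] not_less0)
  qed
qed simp

lemma path_points_Nil: "path_points [] = {(0, 0)}"
  by (auto simp: path_points_def nE_def nN_def)

lemma path_points_Cons:
  "path_points (s # w) = insert (0, 0)
     ((\<lambda>(x, y). if s = E then (Suc x, y) else (x, Suc y)) ` path_points w)"
proof -
  have "path_points (s # w) = (\<lambda>k. (nE (take k (s # w)), nN (take k (s # w)))) ` {..Suc (length w)}"
    by (auto simp: path_points_def)
  also have "{..Suc (length w)} = insert 0 (Suc ` {..length w})" by (rule atMost_Suc_eq_insert_0)
  also have "(\<lambda>k. (nE (take k (s # w)), nN (take k (s # w)))) ` insert 0 (Suc ` {..length w}) =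
    insert (0, 0) ((\<lambda>(x, y). if s = E then (Suc x, y) else (x, Suc y)) `
      (\<lambda>k. (nE (take k w), nN (take k w))) ` {..length w})"
    by (cases s) (simp_all add: image_image nE_def nN_def)
  also have "(\<lambda>k. (nE (take k w), nN (take k w))) ` {..length w} = path_points w"
    by (auto simp: path_points_def)
  finally show ?thesis .
qed

lemma mem_path_points_E:
  "(x, y) \<in> path_points (E # w) \<longleftrightarrow> (x, y) = (0, 0) \<or> (\<exists>x'. x = Suc x' \<and> (x', y) \<in> path_points w)"
  unfolding path_points_Cons by (auto simp: image_iff split: prod.splits)

lemma mem_path_points_N:
  "(x, y) \<in> path_points (N # w) \<longleftrightarrow> (x, y) = (0, 0) \<or> (\<exists>y'. y = Suc y' \<and> (x, y') \<in> path_points w)"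
  unfolding path_points_Cons by (auto simp: image_iff split: prod.splits)

text \<open>At a given height the path runs from the number of E steps strictly below it to the
  number weakly below it; \<open>y\<close> is measured from the current height \<open>cur\<close>.
  The induction is on the number of remaining steps and removes one step at a time, whereas
  \<open>pathE_aux\<close> emits whole runs of N.\<close>

lemma mem_path_points_pathE_aux:
  assumes "sorted a" "\<And>z. z \<in> set a \<Longrightarrow> cur \<le> z \<and> z \<le> q" "cur \<le> q"
  shows "(x, y) \<in> path_points (pathE_aux cur a q) \<longleftrightarrow>
    cur + y \<le> q \<and> count_less a (cur + y) \<le> x \<and> x \<le> count_less a (Suc (cur + y))"
  using assms
proof (induction "length a + (q - cur)" arbitrary: a cur x y rule: less_induct)
  case less
  show ?case
  proof (cases "a \<noteq> [] \<and> hd a = cur")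
    case True
    then obtain zs where a: "a = cur # zs" by (cases a) auto
    have IH: "(x', y) \<in> path_points (pathE_aux cur zs q) \<longleftrightarrow>
      cur + y \<le> q \<and> count_less zs (cur + y) \<le> x' \<and> x' \<le> count_less zs (Suc (cur + y))" for x'
      using less.prems by (intro less.hyps) (auto simp: a)
    have z: "count_less zs cur = 0" using less.prems by (intro count_less_eq_0) (auto simp: a)
    show ?thesis
    proof (cases y)
      case 0
      then show ?thesis using less.prems z IH by (cases x) (auto simp: a mem_path_points_E)
    next
      case (Suc y')
      then show ?thesis using IH by (cases x) (auto simp: a mem_path_points_E)
    qed
  next
    \<comment> \<open>Either the path is over or its first step is N; in both cases no entry equals
      \<open>cur\<close>, so the counts at \<open>cur\<close> and \<open>Suc cur\<close> are
      0.\<close>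
    case False
    then have gt: "Suc cur \<le> z" if "z \<in> set a" for z
    proof -
      have "cur \<le> hd a" "hd a \<noteq> cur" "hd a \<le> z" using False that less.prems by (cases a; auto)+
      then show ?thesis by simp
    qed
    have z: "count_less a cur = 0" "count_less a (Suc cur) = 0"
      using gt by (intro count_less_eq_0, force)+
    show ?thesis
    proof (cases "cur = q")
      case True
      then have "a = []" using gt less.prems by (cases a) force+
      then show ?thesis using True by (auto simp: path_points_Nil)
    next
      case False
      then have "cur < q" using less.prems by simp
      have "pathE_aux cur a q = N # pathE_aux (Suc cur) a q"
        using gt \<open>cur < q\<close> by (cases a) (auto simp: Suc_diff_Suc[symmetric] Suc_le_eq)
      moreover have "(x, y') \<in> path_points (pathE_aux (Suc cur) a q) \<longleftrightarrow>
        Suc cur + y' \<le> q \<and> count_less a (Suc cur + y') \<le> x \<and> x \<le> count_less a (Suc (Suc cur + y'))" for y'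
        using less.prems gt \<open>cur < q\<close> by (intro less.hyps) auto
      ultimately show ?thesis using z \<open>cur < q\<close> by (cases y) (auto simp: mem_path_points_N)
    qed
  qed
qed

lemma mem_path_points_pathE:
  assumes "sorted a" "set a \<subseteq> {..q}"
  shows "(x, y) \<in> path_points (pathE a q) \<longleftrightarrow>
    y \<le> q \<and> count_less a y \<le> x \<and> x \<le> count_less a (Suc y)"
  unfolding pathE_def using mem_path_points_pathE_aux[of a 0 q x y] assms by auto

text \<open>Exchanging the two letters reflects the path in the diagonal and turns
  \<open>pathE_aux\<close> into \<open>pathN_aux\<close>.\<close>

lemma mem_path_points_pathN_aux:
  "(x, y) \<in> path_points (pathN_aux cur b p) \<longleftrightarrow> (y, x) \<in> path_points (pathE_aux cur b p)"
proof -
  define sw where "sw s = (if s = E then N else E)" for s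
  have sw: "sw s = E \<longleftrightarrow> s = N" "sw s = N \<longleftrightarrow> s = E" for s by (cases s; simp add: sw_def)+
  have n: "nE (map sw w) = nN w" "nN (map sw w) = nE w" for w
    by (simp_all add: nE_def nN_def filter_map o_def sw)
  have "pathN_aux cur b p = map sw (pathE_aux cur b p)"
    by (induction b arbitrary: cur) (auto simp: sw_def)
  then show ?thesis by (auto simp: path_points_def take_map n)
qed

lemma mem_path_points_pathN:
  assumes "sorted b" "set b \<subseteq> {..p}"
  shows "(x, y) \<in> path_points (pathN b p) \<longleftrightarrow>
    x \<le> p \<and> count_less b x \<le> y \<and> y \<le> count_less b (Suc x)"
  using mem_path_points_pathE[OF assms, of y x]
  by (simp add: pathN_def pathE_def mem_path_points_pathN_aux)

lemma E_heights_replicate_N: "E_heights h (replicate n N @ w) = E_heights (h + n) w"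
  by (induction n arbitrary: h) auto

lemma E_heights_replicate_E: "E_heights h (replicate n E @ w) = replicate n h @ E_heights h w"
  by (induction n) auto

lemma E_heights_pathE_aux:
  "sorted a \<Longrightarrow> (\<And>z. z \<in> set a \<Longrightarrow> h \<le> z) \<Longrightarrow> E_heights h (pathE_aux h a q) = a"
proof (induction a arbitrary: h)
  case Nil
  show ?case using E_heights_replicate_N[of h "q - h" "[]"] by simp
qed (simp add: E_heights_replicate_N)

text \<open>The E step leaving column \<open>cur + i\<close> comes after all N steps in that column
  as well, hence the count up to \<open>Suc (cur + i)\<close>.\<close>

lemma nth_E_heights_pathN_aux:
  assumes "sorted b" "\<And>z. z \<in> set b \<Longrightarrow> cur \<le> z \<and> z \<le> p" "cur + i < p"
  shows "E_heights h (pathN_aux cur b p) ! i = h + count_less b (Suc (cur + i))"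
  using assms
proof (induction b arbitrary: cur h i)
  case Nil
  then show ?case using E_heights_replicate_E[of h "p - cur" "[]"] by simp
next
  case (Cons z zs)
  have eq: "E_heights h (pathN_aux cur (z # zs) p) = replicate (z - cur) h @ E_heights (Suc h) (pathN_aux z zs p)"
    by (simp add: E_heights_replicate_E)
  have "cur \<le> z" "z \<le> p" using Cons.prems by auto
  show ?case
  proof (cases "i < z - cur")
    case True
    then have "count_less (z # zs) (Suc (cur + i)) = 0"
      using Cons.prems by (intro count_less_eq_0) fastforce
    then show ?thesis unfolding eq using True by (simp add: nth_append)
  next
    case False
    then have "E_heights h (pathN_aux cur (z # zs) p) ! i =
        E_heights (Suc h) (pathN_aux z zs p) ! (i - (z - cur))"
      unfolding eq by (simp add: nth_append)
    also have "\<dots> = Suc h + count_less zs (Suc (z + (i - (z - cur))))"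
      using Cons.prems False by (intro Cons.IH) auto
    also have "z + (i - (z - cur)) = cur + i" using False \<open>cur \<le> z\<close> by simp
    finally show ?thesis using False by auto
  qed
qed

section \<open>Prime pairs of paths as a condition on lattice points\<close>

lemma weakly_above_iff:
  assumes "sorted a" "length a = p" "sorted b" "set b \<subseteq> {..p}"
  shows "weakly_above p (pathN b p) (pathE a q) \<longleftrightarrow> (\<forall>i<p. a ! i \<le> count_less b (Suc i))"
proof -
  have "E_heights 0 (pathE a q) = a" unfolding pathE_def using assms by (intro E_heights_pathE_aux) auto
  moreover have "E_heights 0 (pathN b p) ! i = count_less b (Suc i)" if "i < p" for i
    using nth_E_heights_pathN_aux[of b 0 p i 0] that assms by (auto simp: pathN_def)
  ultimately show ?thesis by (simp add: weakly_above_def)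
qed

text \<open>A point violating the condition is weakly right of where the lower path enters its row
  and weakly above where the upper path enters its column. Every common point is of this kind.
  Conversely, if the upper path is weakly above the lower one, such a point other than the two ends
  forces a forbidden contact.\<close>

lemma prime_path_pair_iff:
  assumes a: "sorted a" "length a = p" "set a \<subseteq> {..q}"
    and b: "sorted b" "length b = q" "set b \<subseteq> {..p}" and pq: "1 \<le> p" "1 \<le> q"
  shows "weakly_above p (pathN b p) (pathE a q) \<and>
      path_points (pathE a q) \<inter> path_points (pathN b p) \<subseteq> {(0, 0), (p, q)} \<longleftrightarrow>
    (\<forall>x\<le>p. \<forall>y\<le>q. (x, y) \<noteq> (0, 0) \<longrightarrow> (x, y) \<noteq> (p, q) \<longrightarrow> x < count_less a y \<or> y < count_less b x)"
    (is "?W \<and> ?D \<longleftrightarrow> ?C")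
proof
  assume C: ?C
  have "a ! i \<le> count_less b (Suc i)" if "i < p" for i
  \<comment> \<open>The test point is where the upper path arrives after its E step number
    \<open>Suc i\<close>. If it is the excepted corner \<open>(p, q)\<close>, the bound
    \<open>a ! i \<le> q\<close> suffices.\<close>
  proof (cases "(Suc i, count_less b (Suc i)) = (p, q)")
    case True
    have "a ! i \<in> set a" using that a by simp
    then have "a ! i \<le> q" using a by blast
    then show ?thesis using True by (metis prod.inject)
  next
    case False
    have "Suc i \<le> p" "count_less b (Suc i) \<le> q" using that b by auto
    then have "Suc i < count_less a (count_less b (Suc i))" using C False by blast
    then show ?thesis using nth_less_iff_count_less[OF a(1), of i "count_less b (Suc i)"] that a
      by simp
  qed
  then have ?W using weakly_above_iff a b by blast
  moreover have ?D
  proof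
    fix z assume z: "z \<in> path_points (pathE a q) \<inter> path_points (pathN b p)"
    obtain x y where xy: "z = (x, y)" by (cases z)
    have "x \<le> p" "y \<le> q" "count_less a y \<le> x" "count_less b x \<le> y"
      using z mem_path_points_pathE[OF a(1,3)] mem_path_points_pathN[OF b(1,3)] by (auto simp: xy)
    then have "(x, y) = (0, 0) \<or> (x, y) = (p, q)" using C by (meson not_le)
    then show "z \<in> {(0, 0), (p, q)}" unfolding xy by blast
  qed
  ultimately show "?W \<and> ?D" by blast
next
  assume WD: "?W \<and> ?D"
  then have W: "a ! i \<le> count_less b (Suc i)" if "i < p" for i
    using that weakly_above_iff[OF a(1,2) b(1,3)] by blast
  have D: "(x, y) = (0, 0) \<or> (x, y) = (p, q)"
    if "x \<le> p" "y \<le> q" "count_less a y \<le> x" "x \<le> count_less a (Suc y)"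
      "count_less b x \<le> y" "y \<le> count_less b (Suc x)" for x y
  proof -
    have "(x, y) \<in> path_points (pathE a q) \<inter> path_points (pathN b p)"
      using that mem_path_points_pathE[OF a(1,3)] mem_path_points_pathN[OF b(1,3)] by auto
    then show ?thesis using WD by blast
  qed
  show ?C
  proof (intro allI impI)
    fix x y assume xy: "x \<le> p" "y \<le> q" "(x, y) \<noteq> (0, 0)" "(x, y) \<noteq> (p, q)"
    show "x < count_less a y \<or> y < count_less b x"
    proof (rule ccontr)
      assume "\<not> ?thesis"
      then have le: "count_less a y \<le> x" "count_less b x \<le> y" by auto
      show False
      \<comment> \<open>The idea is to move down to the entry point of the upper path in column
        \<open>x\<close> and show that it lies on both paths. In column 0 this would be the origin,
        an allowed contact, so that column is treated separately.\<close>
      proof (cases x)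
        case 0
        \<comment> \<open>then the two paths meet in \<open>(0, 1)\<close>\<close>
        then have "1 \<le> y" using xy by simp
        then have a1: "count_less a 1 = 0" using count_less_mono[of 1 y a] le 0 by simp
        then have "\<not> a ! 0 < 1" using nth_less_iff_count_less[OF a(1), of 0 1] a pq by simp
        then have "1 \<le> count_less b 1" using W[of 0] pq by simp
        then show False using D[of 0 1] a1 pq by auto
      next
        case (Suc i)
        let ?y = "count_less b x"
        have "a ! i \<le> ?y" using W[of i] Suc xy by simp
        then have "i < count_less a (Suc ?y)"
          using nth_less_iff_count_less[OF a(1), of i "Suc ?y"] Suc xy a by simp
        moreover have "count_less a ?y \<le> x" using count_less_mono[OF le(2), of a] le(1) by simp
        moreover have "?y \<le> count_less b (Suc x)" by (rule count_less_mono) simp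
        moreover have "?y \<le> q" using b by auto
        ultimately have "(x, ?y) = (p, q)" using D[of x ?y] xy Suc by auto
        then show False using le xy by auto
      qed
    qed
  qed
qed

text \<open>If the complement of \<open>S\<close> has \<open>x\<close> vertices in the first part
  and \<open>y\<close> in the second, the degrees into it are \<open>y\<close> and \<open>x\<close>
  respectively, so the test depends only on \<open>(x, y)\<close>. The two excepted points
  correspond to \<open>S = V\<close> and \<open>S = {}\<close>.\<close>

lemma strict_parking_Kmult_iff:
  assumes fin: "finite X" "finite Y"
  defines "V \<equiv> VP ` X \<union> VQ ` Y"
  assumes f: "f \<in> V \<rightarrow>\<^sub>E {1..}"
  shows "f \<in> strict_parking Kmult V \<longleftrightarrow>
    (\<forall>x\<le>card X. \<forall>y\<le>card Y. (x, y) \<noteq> (0, 0) \<longrightarrow> (x, y) \<noteq> (card X, card Y) \<longrightarrow>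
      x < card {i \<in> X. f (VP i) \<le> y} \<or> y < card {j \<in> Y. f (VQ j) \<le> x})"
    (is "_ \<longleftrightarrow> ?C")
proof
  assume s: "f \<in> strict_parking Kmult V"
  show ?C
  proof (intro allI impI, rule ccontr)
    fix x y assume xy: "x \<le> card X" "y \<le> card Y" "(x, y) \<noteq> (0, 0)" "(x, y) \<noteq> (card X, card Y)"
      and no: "\<not> (x < card {i \<in> X. f (VP i) \<le> y} \<or> y < card {j \<in> Y. f (VQ j) \<le> x})"
    have le: "card {i \<in> X. f (VP i) \<le> y} \<le> x" "card {j \<in> Y. f (VQ j) \<le> x} \<le> y"
      using no by linarith+
    \<comment> \<open>The worst \<open>S\<close> for given sizes: its complement absorbs all
      vertices of small value, which fit by the assumed counts.\<close>
    obtain A where A: "{i \<in> X. f (VP i) \<le> y} \<subseteq> A" "A \<subseteq> X" "card A = x"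
      using exists_subset_between[OF le(1) xy(1) Collect_restrict fin(1)] by (elim exE conjE) (rule that)
    obtain B where B: "{j \<in> Y. f (VQ j) \<le> x} \<subseteq> B" "B \<subseteq> Y" "card B = y"
      using exists_subset_between[OF le(2) xy(2) Collect_restrict fin(2)] by (elim exE conjE) (rule that)
    have fAB: "finite A" "finite B" using A B fin finite_subset by auto
    let ?S = "VP ` (X - A) \<union> VQ ` (Y - B)"
    have VS: "V - ?S = VP ` A \<union> VQ ` B"
      using A(2) B(2) by (simp only: V_def VP_VQ_diff double_diff order_refl)
    have 1: "?S \<subseteq> V" unfolding V_def by blast
    have 2: "?S \<noteq> {}"
    proof
      assume "?S = {}"
      then have "A = X" "B = Y" using A(2) B(2) by auto
      then show False using A(3) B(3) xy(4) by simp
    qed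
    have 3: "?S \<noteq> V"
    proof
      assume "?S = V"
      then have "VP ` A \<union> VQ ` B = {}" unfolding VS[symmetric] by simp
      then have "A = {}" "B = {}" by simp_all
      then show False using A(3) B(3) xy(3) by simp
    qed
    obtain v where v: "v \<in> ?S" "f v \<le> deg Kmult (V - ?S) v"
      using strict_parkingD[OF s 1 2 3] by blast
    from v(1) show False
    proof
      assume "v \<in> VP ` (X - A)"
      then obtain i where "v = VP i" "i \<in> X - A" by blast
      then show False using v(2) A(1) B(3) unfolding VS by (simp add: deg_Kmult_VP[OF fAB] subset_iff) blast
    next
      assume "v \<in> VQ ` (Y - B)"
      then obtain j where "v = VQ j" "j \<in> Y - B" by blast
      then show False using v(2) B(1) A(3) unfolding VS by (simp add: deg_Kmult_VQ[OF fAB] subset_iff) blast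
    qed
  qed
next
  assume C: ?C
  have "\<exists>v\<in>S. f v \<le> deg Kmult (V - S) v" if S: "S \<subseteq> V" "S \<noteq> {}" "S \<noteq> V" for S
  proof -
    have "V - S \<subseteq> VP ` X \<union> VQ ` Y" by (simp add: V_def Diff_subset)
    then obtain A B where AB: "A \<subseteq> X" "B \<subseteq> Y" "V - S = VP ` A \<union> VQ ` B"
      unfolding subset_VP_VQ_iff by blast
    have fAB: "finite A" "finite B" using AB fin finite_subset by auto
    have "S = V - (V - S)" using S(1) by auto
    then have S': "S = VP ` (X - A) \<union> VQ ` (Y - B)"
      unfolding AB(3) by (simp only: V_def VP_VQ_diff)
    have "V - S \<noteq> {}" using S by auto
    then have "(card A, card B) \<noteq> (0, 0)" unfolding AB(3) using fAB by auto
    moreover have "(card A, card B) \<noteq> (card X, card Y)"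
    proof
      assume "(card A, card B) = (card X, card Y)"
      then have "A = X" "B = Y" using card_subset_eq[OF fin(1) AB(1)] card_subset_eq[OF fin(2) AB(2)] by auto
      then show False using S(2) S' by simp
    qed
    moreover have "card A \<le> card X" "card B \<le> card Y" using AB(1,2) fin by (simp_all add: card_mono)
    ultimately have "card A < card {i \<in> X. f (VP i) \<le> card B} \<or> card B < card {j \<in> Y. f (VQ j) \<le> card A}"
      by (intro C[rule_format])
    then show ?thesis
    proof
      assume "card A < card {i \<in> X. f (VP i) \<le> card B}"
      then have "\<not> {i \<in> X. f (VP i) \<le> card B} \<subseteq> A" using card_mono[OF fAB(1)] by (meson not_le)
      then obtain i where "i \<in> X - A" "f (VP i) \<le> card B" by blast
      then show ?thesis
        by (intro bexI[of _ "VP i"]) (simp_all add: AB(3) deg_Kmult_VP[OF fAB], simp add: S')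
    next
      assume "card B < card {j \<in> Y. f (VQ j) \<le> card A}"
      then have "\<not> {j \<in> Y. f (VQ j) \<le> card A} \<subseteq> B" using card_mono[OF fAB(2)] by (meson not_le)
      then obtain j where "j \<in> Y - B" "f (VQ j) \<le> card A" by blast
      then show ?thesis
        by (intro bexI[of _ "VQ j"]) (simp_all add: AB(3) deg_Kmult_VQ[OF fAB], simp add: S')
    qed
  qed
  then show "f \<in> strict_parking Kmult V" using f by (simp add: strict_parking_def)
qed

section \<open>Lists of values and functions on the vertices\<close>

lemma count_less_sort_pred:
  assumes "\<And>x. x \<in> set l \<Longrightarrow> 1 \<le> x"
  shows "count_less (map (\<lambda>x. x - 1) (sort l)) y = length (filter (\<lambda>x. x \<le> y) l)"
proof -
  have "count_less (map (\<lambda>x. x - 1) (sort l)) y = length (filter (\<lambda>x. x \<le> y) (sort l))"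
    using assms by (simp add: filter_map o_def) (intro arg_cong[where f = length] filter_cong; force)
  also have "\<dots> = length (filter (\<lambda>x. x \<le> y) l)"
    by (simp add: filter_sort)
  finally show ?thesis .
qed

lemma length_filter_map_upt:
  "length (filter P (map g [1..<Suc n])) = card {i \<in> {1..n}. P (g i)}"
proof -
  have "length (filter P (map g [1..<Suc n])) = card (set (filter (P \<circ> g) [1..<Suc n]))"
    by (simp only: filter_map length_map distinct_card distinct_filter distinct_upt)
  also have "set (filter (P \<circ> g) [1..<Suc n]) = {i \<in> {1..n}. P (g i)}" by auto
  finally show ?thesis .
qed

lemma mem_PPF_pq_iff:
  assumes pq: "1 \<le> p" "1 \<le> q"
  defines "V \<equiv> VP ` {1..p} \<union> VQ ` {1..q}"
  assumes f: "f \<in> V \<rightarrow>\<^sub>E {1..}"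
    and bP: "\<And>i. i \<in> {1..p} \<Longrightarrow> f (VP i) \<le> q + 1" and bQ: "\<And>j. j \<in> {1..q} \<Longrightarrow> f (VQ j) \<le> p + 1"
  shows "(map (\<lambda>i. f (VP i)) [1..<Suc p], map (\<lambda>i. f (VQ i)) [1..<Suc q]) \<in> PPF_pq p q \<longleftrightarrow>
    f \<in> strict_parking Kmult V"
proof -
  let ?P = "map (\<lambda>i. f (VP i)) [1..<Suc p]" and ?Q = "map (\<lambda>i. f (VQ i)) [1..<Suc q]"
  let ?a = "map (\<lambda>x. x - 1) (sort ?P)" and ?b = "map (\<lambda>x. x - 1) (sort ?Q)"
  have pos: "1 \<le> f v" if "v \<in> V" for v using f that by (auto simp: PiE_iff)
  have sP: "set ?P \<subseteq> {1..q + 1}" using bP pos by (auto simp: V_def)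
  have sQ: "set ?Q \<subseteq> {1..p + 1}" using bQ pos by (auto simp: V_def)
  have srt: "sorted (map (\<lambda>x. x - 1) (sort l))" for l :: "nat list"
    by (intro sorted_map_mono[of _ "\<lambda>x. x - 1"]) (auto intro!: mono_onI)
  have mP: "1 \<le> x \<and> x - 1 \<le> q" if "x \<in> set ?P" for x
    using subsetD[OF sP that] unfolding atLeastAtMost_iff by linarith
  have mQ: "1 \<le> x \<and> x - 1 \<le> p" if "x \<in> set ?Q" for x
    using subsetD[OF sQ that] unfolding atLeastAtMost_iff by linarith
  have cP: "count_less ?a y = card {i \<in> {1..p}. f (VP i) \<le> y}" for y
    using count_less_sort_pred[of ?P y] mP unfolding length_filter_map_upt by blast
  have cQ: "count_less ?b y = card {j \<in> {1..q}. f (VQ j) \<le> y}" for y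
    using count_less_sort_pred[of ?Q y] mQ unfolding length_filter_map_upt by blast
  have "(?P, ?Q) \<in> PPF_pq p q \<longleftrightarrow> weakly_above p (pathN ?b p) (pathE ?a q) \<and>
         path_points (pathE ?a q) \<inter> path_points (pathN ?b p) \<subseteq> {(0,0), (p,q)}"
    using sP sQ unfolding PPF_pq_def Let_def by simp
  also have "\<dots> \<longleftrightarrow> (\<forall>x\<le>p. \<forall>y\<le>q. (x, y) \<noteq> (0, 0) \<longrightarrow> (x, y) \<noteq> (p, q) \<longrightarrow>
      x < count_less ?a y \<or> y < count_less ?b x)"
  proof (rule prime_path_pair_iff)
    show "set ?a \<subseteq> {..q}" using mP unfolding set_map set_sort by blast
    show "set ?b \<subseteq> {..p}" using mQ unfolding set_map set_sort by blast
  qed (simp_all only: srt pq length_map length_sort length_upt diff_Suc_1)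
  also have "\<dots> \<longleftrightarrow> f \<in> strict_parking Kmult V"
    unfolding cP cQ V_def using strict_parking_Kmult_iff[of "{1..p}" "{1..q}" f] f
    by (simp add: V_def)
  finally show ?thesis .
qed

text \<open>Testing a singleton bounds the value by the number of neighbours; this provides the
  range bounds built into \<open>PPF_pq\<close>.\<close>

lemma strict_parking_Kmult_le:
  assumes pq: "1 \<le> p" "1 \<le> q" and f: "f \<in> strict_parking Kmult (VP ` {1..p} \<union> VQ ` {1..q})"
  shows "i \<in> {1..p} \<Longrightarrow> f (VP i) \<le> q" "j \<in> {1..q} \<Longrightarrow> f (VQ j) \<le> p"
proof -
  let ?V = "VP ` {1..p} \<union> VQ ` {1..q}"
  have le: "f v \<le> deg Kmult ?V v" if "v \<in> ?V" for v
  proof -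
    have "VP 1 \<in> ?V" "VQ 1 \<in> ?V" using pq by auto
    then have "{v} \<noteq> ?V" by (metis kv.distinct(5) singletonD)
    then have "f v \<le> deg Kmult (?V - {v}) v" using strict_parkingD[OF f, of "{v}"] that by auto
    also have "\<dots> \<le> deg Kmult ?V v" by (rule deg_mono) auto
    finally show ?thesis .
  qed
  show "i \<in> {1..p} \<Longrightarrow> f (VP i) \<le> q" using le[of "VP i"] by (simp add: deg_Kmult_VP)
  show "j \<in> {1..q} \<Longrightarrow> f (VQ j) \<le> p" using le[of "VQ j"] by (simp add: deg_Kmult_VQ)
qed

theorem theorem3p11:
  fixes p q :: nat
  assumes "1 \<le> p" and "1 \<le> q"
  shows "(PPF_pq p q =
           (\<lambda>f. (map (\<lambda>i. f (VP i)) [1..<Suc p], map (\<lambda>i. f (VQ i)) [1..<Suc q]))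
             ` PPF_graph Kmult (KV p q) V0) \<and>
         (int (card (PPF_graph Kmult (KV p q) V0)) =
           int p ^ q * (int q - 1) ^ (p - 1) + int q ^ p * (int p - 1) ^ (q - 1)
           - (int p + int q - 1) * (int p - 1) ^ (q - 1) * (int q - 1) ^ (p - 1))"
proof -
  let ?V = "VP ` {1..p} \<union> VQ ` {1..q}"
  let ?\<phi> = "\<lambda>f. (map (\<lambda>i. f (VP i)) [1..<Suc p], map (\<lambda>i. f (VQ i)) [1..<Suc q])"
  have "PPF_pq p q = ?\<phi> ` strict_parking Kmult ?V"
  proof (rule Set.set_eqI, rule iffI)
    fix z assume z: "z \<in> PPF_pq p q"
    obtain fP fQ where zz: "z = (fP, fQ)" by (cases z)
    have len: "length fP = p" "length fQ = q" and sets: "set fP \<subseteq> {1..q+1}" "set fQ \<subseteq> {1..p+1}"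
      using z unfolding zz PPF_pq_def by auto
    \<comment> \<open>The vertices are numbered from 1 and list positions from 0. The value at
      \<open>V0\<close> is a mere filler, since \<open>V0\<close> is outside
      \<open>?V\<close>.\<close>
    define f where "f = (\<lambda>v\<in>?V. case v of VP i \<Rightarrow> fP ! (i - 1) | VQ j \<Rightarrow> fQ ! (j - 1) | V0 \<Rightarrow> 0)"
    have fP: "f (VP i) = fP ! (i - 1)" if "i \<in> {1..p}" for i using that by (simp add: f_def)
    have fQ: "f (VQ j) = fQ ! (j - 1)" if "j \<in> {1..q}" for j using that by (simp add: f_def)
    have mP: "f (VP i) \<in> {1..q+1}" if "i \<in> {1..p}" for i
    proof -
      have "fP ! (i - 1) \<in> set fP" using that len by (intro nth_mem) auto
      then show ?thesis using sets fP[OF that] by auto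
    qed
    have mQ: "f (VQ j) \<in> {1..p+1}" if "j \<in> {1..q}" for j
    proof -
      have "fQ ! (j - 1) \<in> set fQ" using that len by (intro nth_mem) auto
      then show ?thesis using sets fQ[OF that] by auto
    qed
    have "map (\<lambda>i. f (VP i)) [1..<Suc p] = fP"
      by (rule nth_equalityI) (auto simp: len fP simp del: upt_Suc)
    moreover have "map (\<lambda>j. f (VQ j)) [1..<Suc q] = fQ"
      by (rule nth_equalityI) (auto simp: len fQ simp del: upt_Suc)
    ultimately have eq: "?\<phi> f = z" by (simp only: zz)
    have ext: "f \<in> ?V \<rightarrow>\<^sub>E {1..}"
    proof (rule PiE_I)
      show "f v \<in> {1..}" if "v \<in> ?V" for v using that mP mQ by auto
    qed (simp add: f_def)
    have "?\<phi> f \<in> PPF_pq p q \<longleftrightarrow> f \<in> strict_parking Kmult ?V"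
      using mP mQ by (intro mem_PPF_pq_iff assms ext) auto
    then have "f \<in> strict_parking Kmult ?V" using z unfolding eq by simp
    then show "z \<in> ?\<phi> ` strict_parking Kmult ?V" by (rule image_eqI[where f = ?\<phi>, OF eq[symmetric]])
  next
    fix z assume "z \<in> ?\<phi> ` strict_parking Kmult ?V"
    then obtain f where f: "f \<in> strict_parking Kmult ?V" and z: "z = ?\<phi> f" by blast
    have "?\<phi> f \<in> PPF_pq p q \<longleftrightarrow> f \<in> strict_parking Kmult ?V"
    proof (rule mem_PPF_pq_iff[OF assms])
      show "f \<in> ?V \<rightarrow>\<^sub>E {1..}" using f by (simp add: strict_parking_def)
    qed (use strict_parking_Kmult_le[OF assms f] in \<open>simp_all add: le_SucI\<close>)
    then show "z \<in> PPF_pq p q" using f z by simp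
  qed
  moreover have "int (card (strict_parking Kmult ?V)) =
      int p ^ q * (int q - 1) ^ (p - 1) + int q ^ p * (int p - 1) ^ (q - 1)
           - (int p + int q - 1) * (int p - 1) ^ (q - 1) * (int q - 1) ^ (p - 1)"
    using card_strict_parking_Kmult[of "{1..p}" "{1..q}"] assms by simp
  ultimately show ?thesis unfolding PPF_graph_KV[OF assms] by (rule conjI)
qed

end
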